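(* For each positive integer $d$ there exists an integer $h_d$ such that for every integer $h\ge h_d$ there exists a fullerene with pentagon separation at least $d$ having exactly $h$ hexagonal faces.
   Context: A fullerene is a cubic (3-regular) plane graph all of whose faces are pentagons or hexagons (it has exactly 12 pentagonal faces). The face-distance between two faces is the graph distance between them in the dual graph (faces as vertices, adjacent iff they share an edge). The pentagon separation of a fullerene is the least face-distance between two distinct pentagonal faces. *)

theory Defs
  imports "Graph_Theory.Graph_Theory" "HOL-Combinatorics.Orbits"
begin

text \<open>
  A plane graph is represented, up to homeomorphism, as a combinatorial map of genus 0.
  The underlying graph is a finite simple graph in the sense of \<open>pair_graph\<close>: each
  undirected edge \<open>{u, v}\<close> appears as the two arcs \<open>(u, v)\<close> and \<open>(v, u)\<close>. The embedding
  is given by a rotation system \<open>rot\<close>, which sends each arc to the next arc with the same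
  tail in the cyclic order around that tail.
\<close>

definition rotation_system :: "'a pair_pre_digraph \<Rightarrow> ('a \<times> 'a \<Rightarrow> 'a \<times> 'a) \<Rightarrow> bool" where
  "rotation_system G rot \<longleftrightarrow>
     rot permutes parcs G \<and>
     (\<forall>v\<in>pverts G. out_arcs G v \<noteq> {} \<longrightarrow> cyclic_on rot (out_arcs G v))"

text \<open>
  A face is identified with the set of arcs along its boundary walk (traversed with the
  face on a fixed side). An edge having the same face on both sides contributes both of
  its arcs, so the cardinality of a face is the length of its boundary walk.
\<close>

definition face_step :: "('a \<times> 'a \<Rightarrow> 'a \<times> 'a) \<Rightarrow> 'a \<times> 'a \<Rightarrow> 'a \<times> 'a" where
  "face_step rot a = rot (prod.swap a)"

definition faces :: "'a pair_pre_digraph \<Rightarrow> ('a \<times> 'a \<Rightarrow> 'a \<times> 'a) \<Rightarrow> ('a \<times> 'a) set set" where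
  "faces G rot = orbit (face_step rot) ` parcs G"

definition euler_char :: "'a pair_pre_digraph \<Rightarrow> ('a \<times> 'a \<Rightarrow> 'a \<times> 'a) \<Rightarrow> int" where
  "euler_char G rot =
     int (card (pverts G)) - int (card (parcs G) div 2) + int (card (faces G rot))"

text \<open>
  For a connected graph with at least one edge, Euler characteristic 2 says that the closed
  oriented surface obtained by gluing a disc along every face walk is the sphere.
\<close>

definition connected_plane_graph ::
    "'a pair_pre_digraph \<Rightarrow> ('a \<times> 'a \<Rightarrow> 'a \<times> 'a) \<Rightarrow> bool" where
  "connected_plane_graph G rot \<longleftrightarrow>
     pair_graph G \<and> connected G \<and> rotation_system G rot \<and> euler_char G rot = 2"

text \<open>
  In a simple cubic graph a face walk of length at most 6 cannot repeat a vertex, since it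
  would then traverse a bridge in both directions and have length at least 8. Hence faces of
  length 5 and 6 are bounded by genuine cycles.
\<close>

definition pentagons :: "'a pair_pre_digraph \<Rightarrow> ('a \<times> 'a \<Rightarrow> 'a \<times> 'a) \<Rightarrow> ('a \<times> 'a) set set" where
  "pentagons G rot = {f \<in> faces G rot. card f = 5}"

definition hexagons :: "'a pair_pre_digraph \<Rightarrow> ('a \<times> 'a \<Rightarrow> 'a \<times> 'a) \<Rightarrow> ('a \<times> 'a) set set" where
  "hexagons G rot = {f \<in> faces G rot. card f = 6}"

definition fullerene :: "'a pair_pre_digraph \<Rightarrow> ('a \<times> 'a \<Rightarrow> 'a \<times> 'a) \<Rightarrow> bool" where
  "fullerene G rot \<longleftrightarrow>
     connected_plane_graph G rot \<and>
     (\<forall>v\<in>pverts G. out_degree G v = 3) \<and>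
     (\<forall>f\<in>faces G rot. f \<in> pentagons G rot \<or> f \<in> hexagons G rot)"

definition dual_graph ::
    "'a pair_pre_digraph \<Rightarrow> ('a \<times> 'a \<Rightarrow> 'a \<times> 'a) \<Rightarrow> ('a \<times> 'a) set pair_pre_digraph" where
  "dual_graph G rot =
     \<lparr> pverts = faces G rot,
       parcs = {(f, g). f \<in> faces G rot \<and> g \<in> faces G rot \<and> f \<noteq> g \<and>
                        (\<exists>a\<in>f. prod.swap a \<in> g)} \<rparr>"

definition face_distance ::
    "'a pair_pre_digraph \<Rightarrow> ('a \<times> 'a \<Rightarrow> 'a \<times> 'a) \<Rightarrow>
     ('a \<times> 'a) set \<Rightarrow> ('a \<times> 'a) set \<Rightarrow> ereal" where
  "face_distance G rot f g = wf_digraph.\<mu> (dual_graph G rot) (\<lambda>_. 1) f g"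

definition pentagon_separation ::
    "'a pair_pre_digraph \<Rightarrow> ('a \<times> 'a \<Rightarrow> 'a \<times> 'a) \<Rightarrow> ereal" where
  "pentagon_separation G rot =
     (INF (f, g) \<in> {(f, g). f \<in> pentagons G rot \<and> g \<in> pentagons G rot \<and> f \<noteq> g}.
        face_distance G rot f g)"

end

theory Submission
  imports Defs
begin

text \<open>
  List the faces of a fullerene along a spiral. In the dual triangulation the triangles then form
  a strip that is glued to itself along the spiral: the fullerene is a Hamiltonian path
  \<open>0, 1, \<dots>, 2 M - 1\<close> together with the edges \<open>{p n, q n}\<close>, where \<open>p n\<close> and \<open>q n\<close> are the two
  triangles on the spiral edge between the faces \<open>n - 1\<close> and \<open>n\<close>. The face \<open>n\<close> consists of
  the path segments from \<open>p n\<close> to \<open>p (n + 1)\<close> and from \<open>q n\<close> to \<open>q (n + 1)\<close>, joined by two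
  such edges; so, the two ends apart, it is a hexagon iff \<open>p + q\<close> increases by 4, a pentagon iff it
  increases by 3. Hence a fullerene is given by two complementary increasing sequences with
  prescribed sum.

  Starting from a pentagon, hexagons make the spiral widen along five rays. Each ray can be
  stopped by a pentagon, which is placed at an index more than \<open>3 ^ d\<close> times the previous one.
  Adjacent faces have indices within a factor of about 3, so such pentagons have distance at
  least \<open>d\<close>. After five stops the spiral is a tube, which is continued for an arbitrary number
  of faces and closed by a half turned copy of its beginning. As the tube can be lengthened by
  one face at a time, every large number of hexagons occurs.
\<close>

section \<open>The beginning of the spiral\<close>

text \<open>\<open>k n\<close> is the number of pentagons among the faces \<open>1, \<dots>, n - 1\<close> and \<open>l n\<close> the
  index of the last pentagon before face \<open>n\<close>. The test in \<open>q_Suc\<close> asks whether \<open>q n + 1\<close>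
  is a value of \<open>p\<close>, see \<open>q_between\<close>. Five is the number of rays.\<close>

locale spiral_cap =
  fixes C :: nat and p q k l :: "nat \<Rightarrow> nat"
  assumes p_0: "p 0 = 0" and p_1: "p (Suc 0) = 4" and p_2: "p 2 = 8"
    and q_0: "q 0 = 0" and q_1: "q (Suc 0) = 0" and q_2: "q 2 = 0"
    and k_0: "k 0 = 0" and k_1: "k (Suc 0) = 0" and k_2: "k 2 = 0"
    and l_2: "l 2 = 0"
    and q_Suc: "n \<ge> 2 \<Longrightarrow> q (Suc n) = (if p (q n + 3 - n) = q n + 1 then q n + 2 else q n + 1)"
    and k_Suc: "n \<ge> 2 \<Longrightarrow> k (Suc n) =
      (if k n < 5 \<and> q (Suc n) = q n + 1 \<and> C * (l n + 3) < n + 3 then Suc (k n) else k n)"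
    and l_Suc: "n \<ge> 2 \<Longrightarrow> l (Suc n) = (if k (Suc n) = k n then l n else n)"
    and p_Suc: "n \<ge> 2 \<Longrightarrow> p (Suc n) + q (Suc n) + k (Suc n) = p n + q n + k n + 4"
begin

section \<open>Growth and complementarity of the two sequences\<close>

lemma sum_eq: "p n + q n + k n = 4 * n"
proof (induction n)
  case 0
  then show ?case by (simp add: p_0 q_0 k_0)
next
  case (Suc n)
  consider "n = 0" | "n = 1" | "n \<ge> 2" by linarith
  then show ?case
  proof cases
    case 3
    then show ?thesis using Suc p_Suc by simp
  qed (simp_all add: p_1 q_1 k_1 p_2 q_2 k_2 flip: numeral_2_eq_2)
qed

lemma q_gap: "n \<ge> 2 \<Longrightarrow> q (Suc n) = q n + 1 \<or> q (Suc n) = q n + 2"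
  using q_Suc by simp

lemma p_gap: "n \<ge> 2 \<Longrightarrow> p (Suc n) = p n + 2 \<or> p (Suc n) = p n + 3"
  using q_gap[of n] k_Suc[of n] p_Suc[of n] by (auto split: if_splits)

lemma p_gap_ge: "n \<ge> 1 \<Longrightarrow> p n + 2 \<le> p (Suc n)"
  using p_gap[of n] p_1 p_2 by (cases "n = 1") (auto simp: numeral_2_eq_2)

lemma p_growth: "1 \<le> i \<Longrightarrow> p i + 2 * m \<le> p (i + m)"
proof (induction m)
  case (Suc m)
  then show ?case using p_gap_ge[of "i + m"] by simp
qed simp

lemma p_mono: "1 \<le> i \<Longrightarrow> i \<le> j \<Longrightarrow> p i \<le> p j"
  using p_growth[of i "j - i"] by simp

lemma p_upper: "p n \<le> 3 * n + 2"
proof (induction n)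
  case (Suc n)
  consider "n = 0" | "n = 1" | "n \<ge> 2" by linarith
  then show ?case
    using p_gap[of n] Suc by cases (auto simp: p_1 p_2 simp flip: numeral_2_eq_2)
qed (simp add: p_0)

text \<open>The lower bound makes the truncated subtraction in \<open>q n + 2 - n\<close> exact; the
  upper one keeps the looked-up index \<open>q n + 3 - n\<close> below \<open>n\<close>.\<close>

lemma q_bounds: "n \<ge> 2 \<Longrightarrow> n \<le> q n + 2 \<and> q n + 4 \<le> 2 * n"
proof (induction n rule: dec_induct)
  case (step n)
  then show ?case using q_gap[of n] by auto
qed (simp add: q_2)

text \<open>Exactly the terms \<open>p 1, \<dots>, p (q n + 2 - n)\<close> lie below \<open>q n\<close>.\<close>

lemma q_between:
  "n \<ge> 2 \<Longrightarrow> q n < p (q n + 3 - n) \<and> (q n + 2 - n = 0 \<or> p (q n + 2 - n) < q n)"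
proof (induction n rule: dec_induct)
  case base
  then show ?case by (simp add: q_2 p_1)
next
  case (step n)
  note b = q_bounds[OF step.hyps(1)]
  show ?case
  proof (cases "p (q n + 3 - n) = q n + 1")
    case True
    then have q: "q (Suc n) = q n + 2" using q_Suc step.hyps by simp
    \<comment> \<open>Gaps of \<open>p\<close> are at least 2, so the number after a skipped value
      of \<open>p\<close> is again free for \<open>q\<close>.\<close>
    have "p (q n + 3 - n) + 2 \<le> p (Suc (q n + 3 - n))"
      using b by (intro p_gap_ge) linarith
    moreover have "Suc (q n + 3 - n) = q n + 4 - n" using b by linarith
    ultimately show ?thesis using True q by (simp add: numeral_eq_Suc)
  next
    case False
    then have "q (Suc n) = q n + 1" using q_Suc step.hyps by simp
    then show ?thesis using False step.IH by (auto simp: numeral_eq_Suc)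
  qed
qed

text \<open>The bracket in \<open>q_between\<close> puts every term of the increasing
  \<open>p\<close> strictly below or strictly above \<open>q n\<close>.\<close>

lemma p_neq_q:
  assumes "i \<ge> 1" "n \<ge> 2"
  shows "p i \<noteq> q n"
proof (cases "i \<le> q n + 2 - n")
  case True
  then have "p i \<le> p (q n + 2 - n)" using assms by (intro p_mono)
  then show ?thesis using q_between[OF assms(2)] True assms by auto
next
  case False
  then have "p (q n + 3 - n) \<le> p i"
    using q_bounds[OF assms(2)] by (intro p_mono) linarith+
  then show ?thesis using q_between[OF assms(2)] by linarith
qed

text \<open>At the index \<open>q n + 3 - n\<close>, which is less than \<open>n\<close>,
  \<open>p\<close> already exceeds \<open>q n\<close>; one further gap of at least 2 gives the
  3.\<close>

lemma q_less_p: "n \<ge> 1 \<Longrightarrow> q n + 3 \<le> p n"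
proof (cases "n = 1")
  case False
  assume "n \<ge> 1"
  then have n: "n \<ge> 2" using False by simp
  have "p (q n + 3 - n) + 2 * (n - (q n + 3 - n)) \<le> p (q n + 3 - n + (n - (q n + 3 - n)))"
    using q_bounds[OF n] by (intro p_growth) linarith
  moreover have "q n + 3 - n + (n - (q n + 3 - n)) = n" "n - (q n + 3 - n) \<ge> 1"
    using q_bounds[OF n] by linarith+
  ultimately show ?thesis using q_between[OF n] by simp
qed (simp add: p_1 q_1)

section \<open>Five pentagons, then a tube\<close>

lemma k_mono: "i \<le> j \<Longrightarrow> k i \<le> k j"
proof -
  have "k n \<le> k (Suc n)" for n
  proof -
    consider "n = 0" | "n = 1" | "n \<ge> 2" by linarith
    then show ?thesis
      using k_Suc[of n] by cases (auto simp: k_1 k_2 k_0 simp flip: numeral_2_eq_2)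
  qed
  then show "i \<le> j \<Longrightarrow> k i \<le> k j" by (rule lift_Suc_mono_le)
qed

lemma k_le: "k n \<le> 5"
proof (induction n)
  case (Suc n)
  consider "n = 0" | "n = 1" | "n \<ge> 2" by linarith
  then show ?case
    using k_Suc[of n] Suc by cases (auto simp: k_1 k_2 k_0 simp flip: numeral_2_eq_2)
qed (simp add: k_0)

text \<open>\<open>k\<close> grows only in steps where \<open>q\<close> grows by 1, so
  \<open>q + k\<close> never gains more than 2. In \<open>eventually_tube\<close> this keeps the
  subtraction in the offset of the tube from being truncated.\<close>

lemma q_plus_k: "n \<ge> 2 \<Longrightarrow> q n + k n + 4 \<le> 2 * n"
proof (induction n rule: dec_induct)
  case (step n)
  then show ?case using q_gap[of n] k_Suc[of n] by (auto split: if_splits)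
qed (simp add: q_2 k_2)

text \<open>If \<open>q\<close> always increased by 2, counting the values of \<open>p\<close> below \<open>q n\<close> would give
  \<open>k = 5\<close>.\<close>

lemma k_increases:
  assumes "k n0 < 5"
  shows "\<exists>n>n0. k n > k n0"
proof (rule ccontr)
  assume "\<not> ?thesis"
  then have const: "k n = k n0" if "n \<ge> n0" for n
    using k_mono[OF that] that by (metis le_less_linear le_neq_implies_less le_antisym)
  define n2 where "n2 = max 2 n0"
  have l: "l n = l n2" if "n \<ge> n2" for n
    using that
  proof (induction n rule: dec_induct)
    case (step n)
    then have "k (Suc n) = k n" using const[of n] const[of "Suc n"] by (simp add: n2_def)
    then show ?case using l_Suc[of n] step by (simp add: n2_def)
  qed simp
  \<comment> \<open>From \<open>n1\<close> on the distance condition of \<open>k_Suc\<close> holds,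
    so only a gap of 2 in \<open>q\<close> can keep \<open>k\<close> from growing.\<close>
  define n1 where "n1 = max n2 (C * (l n2 + 3))"
  have n1: "n1 \<ge> 2" "n1 \<ge> n2" "n1 \<ge> n0" by (simp_all add: n1_def n2_def)
  have gap: "q (Suc n) = q n + 2" if "n \<ge> n1" for n
  proof (rule ccontr)
    assume "q (Suc n) \<noteq> q n + 2"
    then have "q (Suc n) = q n + 1" using q_gap[of n] that n1 by auto
    moreover have "C * (l n + 3) < n + 3" using l[of n] that by (simp add: n1_def)
    moreover have "k n < 5" using const[of n] that n1 assms by simp
    ultimately have "k (Suc n) = Suc (k n)" using k_Suc[of n] that n1 by simp
    then show False using const[of n] const[of "Suc n"] that n1 by simp
  qed
  have q: "q (n1 + m) = q n1 + 2 * m" for m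
    by (induction m) (use gap in auto)
  have p: "p (n1 + m) = p n1 + 2 * m" for m
    using q[of m] sum_eq[of n1] sum_eq[of "n1 + m"] const[of n1] const[of "n1 + m"] n1 by simp
  \<comment> \<open>Far enough out that the index \<open>q n + 2 - n\<close> is at least
    \<open>n1\<close>, where \<open>p\<close> has slope 2 as well. Then \<open>q_between\<close>
    turns into \<open>p n1 + q n1 + 4 < 4 * n1\<close>.\<close>
  define n where "n = n1 + 2 * n1"
  have qn: "q n = q n1 + 4 * n1" using q[of "2 * n1"] by (simp add: n_def)
  define m where "m = q n + 2 - n - n1"
  have b: "n1 \<le> q n1 + 2" using q_bounds n1 by blast
  have m: "q n + 2 - n = n1 + m" "m = q n1 + 2"
    using b qn n1 unfolding m_def n_def by linarith+
  have "p (n1 + m) < q n" using q_between[of n] m n1 by (auto simp: n_def)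
  then have "p n1 + 2 * (q n1 + 2) < q n1 + 4 * n1" using p[of m] m qn by simp
  then have "k n1 > 4" using sum_eq[of n1] by simp
  then show False using const[OF n1(3)] assms by simp
qed

lemma k_reaches_5: "\<exists>n\<ge>2. k n = 5"
proof -
  have "\<exists>n. k n \<ge> i" if "i \<le> 5" for i
    using that
  proof (induction i)
    case (Suc i)
    then obtain n where n: "k n \<ge> i" by auto
    show ?case
    proof (cases "k n < 5")
      case True
      then show ?thesis using k_increases[OF True] n by (metis Suc_leI le_less_trans)
    next
      case False
      then show ?thesis using Suc.prems by (intro exI[of _ n]) auto
    qed
  qed auto
  then obtain n where "k n \<ge> 5" by blast
  then show ?thesis
    using k_le[of "max 2 n"] k_mono[of n "max 2 n"] by (intro exI[of _ "max 2 n"]) auto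
qed

text \<open>After the fifth pentagon \<open>p j + q j = 4 * j - 5\<close>. As \<open>q\<close> gains
  at most 2 per step from \<open>j\<close> to \<open>n\<close>, this gives
  \<open>p j \<le> q n + 1\<close> for \<open>j = q n + 3 - n\<close>, whereas a gap of 1 after
  \<open>n\<close> would need \<open>p j > q n + 1\<close>. So all later gaps of \<open>q\<close>
  are 2.\<close>

lemma eventually_tube: "\<exists>L x. 2 \<le> L \<and> (\<forall>n\<ge>L. p n = 2 * n + x \<and> q n + x + 5 = 2 * n)"
proof -
  obtain n0 where n0: "n0 \<ge> 2" "k n0 = 5" using k_reaches_5 by blast
  then have k5: "k n = 5" if "n \<ge> n0" for n using k_mono[OF that] k_le[of n] by simp
  \<comment> \<open>Chosen so that \<open>p_upper\<close> and \<open>q_bounds\<close> force the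
    index \<open>j\<close> below to be at least \<open>n0\<close>.\<close>
  define L where "L = 3 * n0 + 10"
  have gap: "q (Suc n) = q n + 2" if n: "n \<ge> L" for n
  proof (rule ccontr)
    assume "q (Suc n) \<noteq> q n + 2"
    moreover have n2: "n \<ge> 2" using n by (simp add: L_def)
    ultimately have g: "q (Suc n) = q n + 1" using q_gap[of n] by auto
    define j where "j = q n + 3 - n"
    note b = q_bounds[OF n2]
    have pj: "p j > q n + 1"
      using q_between[of "Suc n"] n2 g by (simp add: j_def numeral_eq_Suc)
    have "j \<ge> n0" using pj p_upper[of j] b n unfolding L_def by linarith
    have "j \<le> n" using b unfolding j_def by linarith
    have "q n \<le> q j + 2 * (n - j)"
      using \<open>j \<le> n\<close>
    proof (induction n rule: dec_induct)
      case (step n)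
      then show ?case using q_gap[of n] \<open>j \<ge> n0\<close> n0 by auto
    qed simp
    moreover have "p j + q j + 5 = 4 * j" using sum_eq[of j] k5[OF \<open>j \<ge> n0\<close>] by simp
    ultimately have "p j \<le> q n + 1" using b \<open>j \<le> n\<close> unfolding j_def by linarith
    then show False using pj by simp
  qed
  have "q (L + m) = q L + 2 * m" for m by (induction m) (use gap in auto)
  then have q: "q n = q L + 2 * (n - L)" if "n \<ge> L" for n
    using that by (metis le_add_diff_inverse)
  have qL: "q L + 5 \<le> 2 * L" using q_plus_k[of L] k5[of L] by (simp add: L_def)
  have "p n = 2 * n + (2 * L - 5 - q L) \<and> q n + (2 * L - 5 - q L) + 5 = 2 * n" if "n \<ge> L" for n
    using q[OF that] sum_eq[of n] k5[of n] that qL by (auto simp: L_def)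
  moreover have "2 \<le> L" by (simp add: L_def)
  ultimately show ?thesis by blast
qed

section \<open>Spacing of the pentagons in the cap\<close>

definition pentagon :: "nat \<Rightarrow> bool" where
  "pentagon n \<longleftrightarrow> n = 0 \<or> p (Suc n) + q (Suc n) = p n + q n + 3"

lemma pentagonD:
  assumes "pentagon n" "n > 0"
  shows "n \<ge> 2 \<and> k (Suc n) = Suc (k n) \<and> C * (l n + 3) < n + 3 \<and> l (Suc n) = n"
proof -
  have "n \<noteq> 1" using assms by (auto simp: pentagon_def p_1 q_1 p_2 q_2 simp flip: numeral_2_eq_2)
  then have n: "n \<ge> 2" using assms by simp
  have "k (Suc n) = Suc (k n)"
    using assms sum_eq[of n] sum_eq[of "Suc n"] by (simp add: pentagon_def)
  then show ?thesis using n k_Suc[OF n] l_Suc[OF n] by (auto split: if_splits)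
qed

lemma l_le: "n \<ge> 2 \<Longrightarrow> l n \<le> n"
proof (induction n rule: dec_induct)
  case (step n)
  then show ?case using l_Suc[of n] by simp
qed (simp add: l_2)

lemma l_mono: "2 \<le> i \<Longrightarrow> i \<le> j \<Longrightarrow> l i \<le> l j"
proof (rotate_tac, induction j rule: dec_induct)
  case (step n)
  then show ?case using l_Suc[of n] l_le[of n] by auto
qed simp

text \<open>\<open>k_Suc\<close> compares \<open>v\<close> only with the last pentagon
  \<open>l v\<close>; all earlier ones are covered because \<open>l\<close> is monotone.\<close>

lemma pentagons_apart:
  assumes "pentagon u" "pentagon v" "u < v"
  shows "C * (u + 3) < v + 3"
proof -
  have v: "v \<ge> 2" "C * (l v + 3) < v + 3" using pentagonD[of v] assms by auto
  have "u \<le> l v"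
  proof (cases "u = 0")
    case False
    then show ?thesis using pentagonD[of u] l_mono[of "Suc u" v] assms by auto
  qed simp
  then have "C * (u + 3) \<le> C * (l v + 3)" by (intro mult_le_mono) simp_all
  then show ?thesis using v(2) by linarith
qed

lemma gap_3_or_4:
  "p (Suc n) + q (Suc n) = p n + q n + 3 \<or> p (Suc n) + q (Suc n) = p n + q n + 4"
proof -
  consider "n = 0" | "n = 1" | "n \<ge> 2" by linarith
  then show ?thesis
  proof cases
    case 3
    then show ?thesis using p_Suc[of n] k_Suc[of n] by (auto split: if_splits)
  qed (auto simp: p_0 q_0 p_1 q_1 p_2 q_2 simp flip: numeral_2_eq_2)
qed

end

section \<open>Construction of the sequences by recursion\<close>

primrec cap_state :: "nat \<Rightarrow> nat \<Rightarrow> (nat \<Rightarrow> nat) \<times> nat \<times> nat \<times> nat" where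
  "cap_state C 0 = ((\<lambda>i. 4 * i), 0, 0, 0)"
| "cap_state C (Suc i) =
    (let (p, q, k, l) = cap_state C i;
         n = i + 2;
         g = (if p (q + 3 - n) = q + 1 then 2 else 1);
         e = (if k < 5 \<and> g = 1 \<and> C * (l + 3) < n + 3 then 1 else 0)
     in (p(Suc n := p n + 4 - e - g), q + g, k + e, if e = 0 then l else n))"

text \<open>The recursion looks up \<open>p\<close> at an earlier index, so \<open>cap_state\<close>
  carries \<open>p\<close> as a whole function. State \<open>i\<close> belongs to
  \<open>n = i + 2\<close>; the start \<open>4 * i\<close> is right at 0, 1 and 2, and its other
  values are overwritten before they are read.\<close>

lemma spiral_cap_exists: "\<exists>p q k l. spiral_cap C p q k l"
proof -
  define P where "P i = fst (cap_state C i)" for i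
  define Q where "Q i = fst (snd (cap_state C i))" for i
  define K where "K i = fst (snd (snd (cap_state C i)))" for i
  define Z where "Z i = snd (snd (snd (cap_state C i)))" for i
  note defs = P_def Q_def K_def Z_def
  have init: "P 0 = (\<lambda>i. 4 * i)" "Q 0 = 0" "K 0 = 0" "Z 0 = 0" by (simp_all add: defs)
  have Q: "Q (Suc i) = (if P i (Q i + 3 - (i + 2)) = Q i + 1 then Q i + 2 else Q i + 1)" for i
    by (simp add: defs Let_def split_beta)
  have K: "K (Suc i) = (if K i < 5 \<and> Q (Suc i) = Q i + 1 \<and> C * (Z i + 3) < i + 2 + 3
      then Suc (K i) else K i)" for i
    by (simp add: defs Let_def split_beta)
  have Z: "Z (Suc i) = (if K (Suc i) = K i then Z i else i + 2)" for i
    by (simp add: defs Let_def split_beta)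
  have P: "P (Suc i) = (P i)(i + 3 := P i (i + 2) + 4 - (K (Suc i) - K i) - (Q (Suc i) - Q i))" for i
    by (simp add: defs Let_def split_beta numeral_eq_Suc)
  have stable: "P (i + j) m = P i m" if "m \<le> i + 2" for i j m
    by (induction j) (use that P in auto)
  have stable': "P i m = P m m" if "m \<le> i + 2" for i m
    using stable[of m i m] stable[of m m i] that
    by (metis (no_types, lifting) add.commute stable le_add1)
  have Qle: "Q i \<le> 2 * i" for i
  proof (induction i)
    case (Suc i)
    then show ?case using Q[of i] by (simp split: if_splits)
  qed (simp add: init)
  \<comment> \<open>The diagonal \<open>P n n\<close> is the limit of the states, by
    \<open>stable'\<close>. Truncation in \<open>n - 2\<close> supplies the values of the other
    sequences at 0 and 1.\<close>
  have "spiral_cap C (\<lambda>n. P n n) (\<lambda>n. Q (n - 2)) (\<lambda>n. K (n - 2)) (\<lambda>n. Z (n - 2))"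
  proof
    show "P 0 0 = 0" "P (Suc 0) (Suc 0) = 4" "P 2 2 = 8"
      using stable[of 0 0 0] stable[of 1 0 1] stable[of 2 0 2] init by (auto simp: numeral_2_eq_2)
  next
    fix n :: nat assume n: "n \<ge> 2"
    then obtain i where i: "n = i + 2" by (metis add.commute le_Suc_ex)
    have P1: "P i m = P m m" if "m \<le> i + 2" for m using stable'[OF that] .
    have *: "Q i + 3 - n \<le> i + 2" using Qle[of i] i by linarith
    show "Q (Suc n - 2) = (if P (Q (n - 2) + 3 - n) (Q (n - 2) + 3 - n) = Q (n - 2) + 1
        then Q (n - 2) + 2 else Q (n - 2) + 1)"
      using Q[of i] P1[OF *] i by (simp add: Suc_diff_le)
    show "K (Suc n - 2) = (if K (n - 2) < 5 \<and> Q (Suc n - 2) = Q (n - 2) + 1 \<and>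
        C * (Z (n - 2) + 3) < n + 3 then Suc (K (n - 2)) else K (n - 2))"
      using K[of i] i by (simp add: Suc_diff_le)
    show "Z (Suc n - 2) = (if K (Suc n - 2) = K (n - 2) then Z (n - 2) else n)"
      using Z[of i] i by (simp add: Suc_diff_le)
    have "P (Suc n) (Suc n) = P (Suc i) (i + 3)"
      using stable'[of "i + 3" "Suc i"] i by (simp add: numeral_eq_Suc)
    also have "\<dots> = P n n + 4 - (K (Suc i) - K i) - (Q (Suc i) - Q i)"
      using P[of i] P1[of n] i by simp
    finally show "P (Suc n) (Suc n) + Q (Suc n - 2) + K (Suc n - 2)
        = P n n + Q (n - 2) + K (n - 2) + 4"
      using Q[of i] K[of i] i by (auto simp: Suc_diff_le)
  qed (simp_all add: init)
  then show ?thesis by blast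
qed

section \<open>The map of a closed spiral\<close>

text \<open>The boundary walk of a face: down the path from \<open>d\<close> to \<open>c\<close>,
  across to \<open>a\<close>, up the path to \<open>b\<close>, and across to \<open>d\<close>. The
  conditionals allow either segment to be a single vertex.\<close>

lemma face_walk_cyclic:
  fixes f :: "nat \<times> nat \<Rightarrow> nat \<times> nat"
  assumes "a \<le> b" "c \<le> d"
    and bd: "f (b, d) = (if c < d then (d, d - 1) else (c, a))"
    and backward: "\<And>t. c \<le> t \<Longrightarrow> t < d \<Longrightarrow> f (Suc t, t) = (if c < t then (t, t - 1) else (c, a))"
    and ca: "f (c, a) = (if a < b then (a, Suc a) else (b, d))"
    and forward: "\<And>t. a \<le> t \<Longrightarrow> t < b \<Longrightarrow>
      f (t, Suc t) = (if Suc t < b then (Suc t, Suc (Suc t)) else (b, d))"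
  shows "cyclic_on f ({(t, Suc t) |t. a \<le> t \<and> t < b} \<union> {(Suc t, t) |t. c \<le> t \<and> t < d}
    \<union> {(b, d), (c, a)})"
    (is "cyclic_on f ?S")
proof (rule cyclic_on_singleI)
  let ?O = "orbit f (b, d)"
  show "(b, d) \<in> ?S" by simp
  have step: "f x \<in> ?O" if "x \<in> ?O" for x using that by (rule orbit.step)
  have base: "f (b, d) \<in> ?O" by (rule orbit.base)
  have B: "(Suc t, t) \<in> ?O" if "c \<le> t" "t < d" for t
    using that(2,1)
  proof (induction t rule: strict_inc_induct)
    case (base t)
    then show ?case using \<open>f (b, d) \<in> ?O\<close> bd by (metis diff_Suc_1 le_imp_less_Suc)
  next
    case (step t)
    then have "f (Suc (Suc t), Suc t) \<in> ?O" by (intro orbit.step) simp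
    then show ?case using backward[of "Suc t"] step by simp
  qed
  have CA: "(c, a) \<in> ?O"
  proof (cases "c < d")
    case True
    then show ?thesis using step[OF B[of c]] backward[of c] by simp
  next
    case False
    then show ?thesis using base bd by simp
  qed
  have A: "(t, Suc t) \<in> ?O" if "a \<le> t" "t < b" for t
    using that
  proof (induction t rule: dec_induct)
    case base
    then show ?case using step[OF CA] ca by simp
  next
    case (step t)
    then have "f (t, Suc t) \<in> ?O" by (intro orbit.step) simp
    then show ?case using forward[of t] step by simp
  qed
  have BD: "(b, d) \<in> ?O"
  proof (cases "a < b")
    case True
    then have "Suc (b - 1) = b" "a \<le> b - 1" "b - 1 < b" by auto
    then show ?thesis using step[OF A[of "b - 1"]] forward[of "b - 1"] by simp
  next
    case False
    then show ?thesis using step[OF CA] ca by simp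
  qed
  have closed: "f x \<in> ?S" if "x \<in> ?S" for x
  proof -
    from that consider (1) t where "x = (t, Suc t)" "a \<le> t" "t < b"
      | (2) t where "x = (Suc t, t)" "c \<le> t" "t < d" | (3) "x = (b, d)" | (4) "x = (c, a)"
      by auto
    then show ?thesis
    proof cases
      case (1 t)
      then show ?thesis using forward[of t] by simp
    next
      case (2 t)
      have "(t, t - 1) \<in> ?S" if "c < t" using that 2 by (auto intro!: exI[of _ "t - 1"])
      then show ?thesis using 2 backward[of t] by auto
    next
      case 3
      have "(d, d - 1) \<in> ?S" if "c < d" using that by (auto intro!: exI[of _ "d - 1"])
      then show ?thesis using 3 bd by auto
    next
      case 4
      then show ?thesis using ca by auto
    qed
  qed
  show "?S = ?O"
  proof
    show "?S \<subseteq> ?O" using A B CA BD by auto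
    show "?O \<subseteq> ?S"
    proof
      fix y assume "y \<in> ?O"
      then show "y \<in> ?S" by induction (auto intro!: closed simp del: Un_iff Un_insert_right)
    qed
  qed
qed

lemma cyclic_on_3I:
  assumes "f x = y" "f y = z" "f z = x"
  shows "cyclic_on f {x, y, z}"
proof (rule cyclic_on_singleI[of x])
  have "f x \<in> orbit f x" "f (f x) \<in> orbit f x" "f (f (f x)) \<in> orbit f x"
    by (auto intro: orbit.intros)
  moreover have "w \<in> {x, y, z}" if "w \<in> orbit f x" for w
    using that by induction (use assms in auto)
  ultimately show "{x, y, z} = orbit f x" using assms by auto
qed simp

text \<open>For the first and the last face, which have only one path segment and one further
  edge.\<close>

lemma cyclic_on_5I:
  assumes "f v = w" "f w = x" "f x = y" "f y = z" "f z = v"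
  shows "cyclic_on f {v, w, x, y, z}"
proof (rule cyclic_on_singleI[of v])
  have "f v \<in> orbit f v" "f (f v) \<in> orbit f v" "f (f (f v)) \<in> orbit f v"
    "f (f (f (f v))) \<in> orbit f v" "f (f (f (f (f v)))) \<in> orbit f v"
    by (intro orbit.intros)+
  moreover have "u \<in> {v, w, x, y, z}" if "u \<in> orbit f v" for u
    using that by induction (use assms in auto)
  ultimately show "{v, w, x, y, z} = orbit f v" using assms by auto
qed simp

section \<open>Lower bounds on distances from weights\<close>

lemma walk_weight_bound:
  fixes w :: "'a \<Rightarrow> nat"
  assumes "\<And>f g. (f, g) \<in> A \<Longrightarrow> w g \<le> c * w f \<and> w f \<le> c * w g"
    and "pcas f es g" "set es \<subseteq> A"
  shows "w g \<le> c ^ length es * w f \<and> w f \<le> c ^ length es * w g"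
  using assms(2,3)
proof (induction es arbitrary: f)
  case (Cons e es)
  define k where "k = c ^ length es"
  have IH: "w g \<le> k * w (snd e)" "w (snd e) \<le> k * w g"
    using Cons unfolding k_def by auto
  have e: "w (snd e) \<le> c * w f" "w f \<le> c * w (snd e)"
    using assms(1)[of "fst e" "snd e"] Cons.prems by auto
  have "w g \<le> k * (c * w f)" using IH(1) mult_le_mono2[OF e(1), of k] by (rule le_trans)
  moreover have "w f \<le> c * (k * w g)" using e(2) mult_le_mono2[OF IH(2), of c] by (rule le_trans)
  ultimately show ?case by (simp add: k_def ac_simps)
qed simp

text \<open>A walk with fewer than \<open>d\<close> arcs changes \<open>w\<close> by a factor of at
  most \<open>c ^ d\<close>, too little to join \<open>f\<close> and \<open>g\<close>; at unit cost
  the cost of a walk is its length.\<close>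

lemma face_distance_ge:
  fixes w :: "('a \<times> 'a) set \<Rightarrow> nat"
  assumes lip: "\<And>f g. (f, g) \<in> parcs (dual_graph G rot) \<Longrightarrow> w g \<le> c * w f \<and> w f \<le> c * w g"
    and far: "c ^ d * w f < w g \<or> c ^ d * w g < w f" and "c \<ge> 1"
  shows "face_distance G rot f g \<ge> ereal (real d)"
proof -
  let ?D = "dual_graph G rot"
  interpret pair_wf_digraph ?D by unfold_locales (auto simp: dual_graph_def)
  have "d \<le> length es" if "awalk f es g" for es
  proof (rule ccontr)
    assume "\<not> d \<le> length es"
    then have le: "c ^ length es \<le> c ^ d" using assms(3) by (intro power_increasing) auto
    have cas: "pcas f es g" "set es \<subseteq> parcs ?D" using that by (auto simp: awalk_def)
    have "w g \<le> c ^ length es * w f \<and> w f \<le> c ^ length es * w g"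
      using lip cas by (rule walk_weight_bound)
    then show False
      using far mult_le_mono1[OF le, of "w f"] mult_le_mono1[OF le, of "w g"] by linarith
  qed
  moreover have "awalk_cost (\<lambda>_. 1) es = real (length es)" for es :: "(('a \<times> 'a) set \<times> ('a \<times> 'a) set) awalk"
    by (simp add: awalk_cost_def sum_list_triv)
  ultimately show ?thesis
    unfolding face_distance_def \<mu>_def by (auto intro!: INF_greatest)
qed

text \<open>The two ends are degenerate: vertex 0 is both \<open>q 1\<close> and \<open>q 2\<close>, vertex \<open>2 M - 1\<close> both
  \<open>p M\<close> and \<open>p (M + 1)\<close>. The values at \<open>0\<close> and \<open>M + 2\<close> do not belong to edges; they delimit
  the path segments of the first and the last face.\<close>

locale spiral_map =
  fixes M :: nat and p q :: "nat \<Rightarrow> nat"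
  assumes M_ge: "M \<ge> 12"
    and p_0: "p 0 = 0" and p_1: "p (Suc 0) = 4"
    and q_0: "q 0 = 0" and q_1: "q (Suc 0) = 0" and q_2: "q 2 = 0"
    and p_M: "p M = 2 * M - 1" and p_M1: "p (Suc M) = 2 * M - 1" and p_M2: "p (M + 2) = 2 * M - 1"
    and q_M1: "q (Suc M) = 2 * M - 5" and q_M2: "q (M + 2) = 2 * M - 1"
    and p_less_Suc: "1 \<le> i \<Longrightarrow> i < M \<Longrightarrow> p i < p (Suc i)"
    and q_less_Suc: "2 \<le> i \<Longrightarrow> i \<le> M + 1 \<Longrightarrow> q i < q (Suc i)"
    and q_less_p: "1 \<le> n \<Longrightarrow> n \<le> M + 1 \<Longrightarrow> q n + 3 \<le> p n"
    and p_neq_q: "1 \<le> i \<Longrightarrow> i \<le> M \<Longrightarrow> 2 \<le> j \<Longrightarrow> j \<le> M + 1 \<Longrightarrow> p i \<noteq> q j"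
    and gap_3_or_4: "n \<le> M + 1 \<Longrightarrow>
      p (Suc n) + q (Suc n) = p n + q n + 3 \<or> p (Suc n) + q (Suc n) = p n + q n + 4"
    and p_upper: "n \<le> M + 2 \<Longrightarrow> p n \<le> 3 * n + 2"
    and q_lower: "n \<le> M + 2 \<Longrightarrow> 3 * n \<le> q n + M + 9"
begin

section \<open>Monotonicity, and partition of the vertices\<close>

lemma p_less: "1 \<le> i \<Longrightarrow> i < j \<Longrightarrow> j \<le> M \<Longrightarrow> p i < p j"
proof (induction j)
  case (Suc j)
  then show ?case using p_less_Suc[of j] by (cases "i = j") auto
qed simp

lemma q_less: "2 \<le> i \<Longrightarrow> i < j \<Longrightarrow> j \<le> M + 2 \<Longrightarrow> q i < q j"
proof (induction j)
  case (Suc j)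
  then show ?case using q_less_Suc[of j] by (cases "i = j") auto
qed simp

lemma p_mono_Suc: "n \<le> M + 1 \<Longrightarrow> p n \<le> p (Suc n)"
proof -
  assume "n \<le> M + 1"
  then consider "n = 0" | "1 \<le> n" "n < M" | "n = M" | "n = Suc M" by linarith
  then show ?thesis using p_0 p_less_Suc[of n] p_M p_M1 p_M2 by cases auto
qed

lemma q_mono_Suc: "n \<le> M + 1 \<Longrightarrow> q n \<le> q (Suc n)"
proof -
  assume "n \<le> M + 1"
  then consider "n = 0" | "n = 1" | "2 \<le> n" "n \<le> M + 1" by linarith
  then show ?thesis using q_0 q_1 q_2 q_less_Suc[of n] by cases auto
qed

lemma p_mono: "i \<le> j \<Longrightarrow> j \<le> M + 2 \<Longrightarrow> p i \<le> p j"
proof (induction j rule: dec_induct)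
  case (step j)
  then show ?case using p_mono_Suc[of j] by simp
qed simp

lemma q_mono: "i \<le> j \<Longrightarrow> j \<le> M + 2 \<Longrightarrow> q i \<le> q j"
proof (induction j rule: dec_induct)
  case (step j)
  then show ?case using q_mono_Suc[of j] by simp
qed simp

lemma p_inj: "inj_on p {1..M}"
  by (rule linorder_inj_onI) (use p_less in fastforce)+

lemma q_inj: "inj_on q {2..M + 1}"
  by (rule linorder_inj_onI) (use q_less in fastforce)+

lemma p_lt: "n \<le> M + 2 \<Longrightarrow> p n < 2 * M"
  using p_mono[of n "M + 2"] p_M2 M_ge by linarith

lemma q_le: "n \<le> M + 1 \<Longrightarrow> q n \<le> 2 * M - 5"
  using q_mono[of n "Suc M"] q_M1 by simp

text \<open>Counting: \<open>M\<close> values of \<open>p\<close> and \<open>M\<close> values of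
  \<open>q\<close>, disjoint and all below \<open>2 * M\<close>, must exhaust the vertices.\<close>

lemma partition: "p ` {1..M} \<union> q ` {2..M + 1} = {..<2 * M}"
proof (rule card_subset_eq)
  show "p ` {1..M} \<union> q ` {2..M + 1} \<subseteq> {..<2 * M}"
    using p_lt q_le M_ge by fastforce
  have "p ` {1..M} \<inter> q ` {2..M + 1} = {}" using p_neq_q by auto
  then show "card (p ` {1..M} \<union> q ` {2..M + 1}) = card {..<2 * M}"
    using p_inj q_inj by (simp add: card_Un_disjoint card_image)
qed simp

lemma vertex_cases:
  assumes "u < 2 * M"
  obtains n where "1 \<le> n" "n \<le> M" "u = p n" | n where "2 \<le> n" "n \<le> M + 1" "u = q n"
proof -
  have "u \<in> p ` {1..M} \<union> q ` {2..M + 1}" using assms unfolding partition by simp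
  then show thesis using that by auto
qed

section \<open>The cubic graph and its rotation system\<close>

definition partner :: "nat \<Rightarrow> nat" where
  "partner u = (if u \<in> p ` {1..M} then q (inv_into {1..M} p u) else p (inv_into {2..M + 1} q u))"

text \<open>Vertex 0 lies on the spiral edges 1 and 2. \<open>partner\<close> gives the second, and
  the first, to \<open>p 1 = 4\<close>, replaces the missing path predecessor. Likewise
  \<open>succ\<close> gives \<open>2 * M - 1\<close> the edge to \<open>q (Suc M)\<close>.\<close>

definition pred :: "nat \<Rightarrow> nat" where
  "pred u = (if u = 0 then 4 else u - 1)"

definition succ :: "nat \<Rightarrow> nat" where
  "succ u = (if u = 2 * M - 1 then 2 * M - 5 else Suc u)"

lemma partner_p: "1 \<le> n \<Longrightarrow> n \<le> M \<Longrightarrow> partner (p n) = q n"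
  using p_inj by (simp add: partner_def)

lemma q_not_p: "2 \<le> n \<Longrightarrow> n \<le> M + 1 \<Longrightarrow> q n \<notin> p ` {1..M}"
  using p_neq_q by fastforce

lemma partner_q: "2 \<le> n \<Longrightarrow> n \<le> M + 1 \<Longrightarrow> partner (q n) = p n"
  using q_inj q_not_p by (simp add: partner_def)

text \<open>This makes the graph simple and cubic: path neighbours differ by 1, ends of spiral edges
  by at least 3, and monotonicity settles the two end vertices.\<close>

lemma neighbours_distinct:
  assumes "u < 2 * M"
  shows "pred u \<noteq> succ u" "pred u \<noteq> partner u" "succ u \<noteq> partner u"
    "pred u \<noteq> u" "succ u \<noteq> u" "partner u \<noteq> u"
proof -
  show "pred u \<noteq> succ u" "pred u \<noteq> u" "succ u \<noteq> u"
    using M_ge by (auto simp: pred_def succ_def)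
  from assms show "partner u \<noteq> u"
  proof (cases rule: vertex_cases)
    case (1 n)
    then show ?thesis using q_less_p[of n] by (simp add: partner_p)
  next
    case (2 n)
    then show ?thesis using q_less_p[of n] by (simp add: partner_q)
  qed
  show "pred u \<noteq> partner u"
    using assms
  proof (cases rule: vertex_cases)
    case (1 n)
    then show ?thesis using q_less_p[of n] by (auto simp: partner_p pred_def)
  next
    case (2 n)
    have "4 < p n" using p_less[of 1 2] p_mono[of 2 n] 2 p_1 M_ge by simp
    then show ?thesis using 2 q_less_p[of n] by (auto simp: partner_q pred_def)
  qed
  show "succ u \<noteq> partner u"
    using assms
  proof (cases rule: vertex_cases)
    case (1 n)
    have "q n < 2 * M - 5" using 1 q_M1 q_less[of n "Suc M"] q_1 M_ge by (cases "n = 1") auto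
    then show ?thesis using 1 q_less_p[of n] by (auto simp: partner_p succ_def)
  next
    case (2 n)
    then show ?thesis using q_less_p[of n] q_le[of n] M_ge by (auto simp: partner_q succ_def)
  qed
qed

lemma neighbours_lt:
  assumes "u < 2 * M"
  shows "pred u < 2 * M" "succ u < 2 * M" "partner u < 2 * M"
proof -
  show "pred u < 2 * M" "succ u < 2 * M" using M_ge assms by (auto simp: pred_def succ_def)
  from assms show "partner u < 2 * M"
  proof (cases rule: vertex_cases)
    case (1 n)
    then show ?thesis using q_le[of n] M_ge by (simp add: partner_p)
  next
    case (2 n)
    then show ?thesis using p_lt[of n] by (simp add: partner_q)
  qed
qed

definition neighbours :: "nat \<Rightarrow> nat set" where
  "neighbours u = {pred u, succ u, partner u}"

lemma finite_neighbours: "finite (neighbours u)"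
  by (simp add: neighbours_def)

lemma card_neighbours: "u < 2 * M \<Longrightarrow> card (neighbours u) = 3"
  using neighbours_distinct by (simp add: neighbours_def)

text \<open>\<open>partner\<close> is no involution at the ends: \<open>partner 4 = 0\<close>, but
  \<open>partner 0 = p 2\<close>. There \<open>pred\<close> and \<open>succ\<close> supply the
  reverse arc.\<close>

lemma mem_neighbours_partner:
  assumes "u < 2 * M"
  shows "u \<in> neighbours (partner u)"
  using assms
proof (cases rule: vertex_cases)
  case (1 n)
  show ?thesis
  proof (cases "n = 1")
    case True
    then have "partner u = 0" "u = pred 0" using 1 partner_p[of n] q_1 p_1 by (auto simp: pred_def)
    then show ?thesis by (simp add: neighbours_def)
  next
    case False
    then show ?thesis using 1 by (auto simp: partner_p partner_q neighbours_def)
  qed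
next
  case (2 n)
  show ?thesis
  proof (cases "n = Suc M")
    case True
    then have "u = succ (2 * M - 1)" "partner u = 2 * M - 1"
      using 2 partner_q[of n] p_M1 q_M1 by (auto simp: succ_def)
    then show ?thesis by (simp add: neighbours_def)
  next
    case False
    then show ?thesis using 2 by (auto simp: partner_p partner_q neighbours_def)
  qed
qed

lemma neighbours_sym:
  assumes "u < 2 * M" "v \<in> neighbours u"
  shows "u \<in> neighbours v"
proof -
  consider "v = pred u" | "v = succ u" | "v = partner u" using assms by (auto simp: neighbours_def)
  then show ?thesis
  proof cases
    case 1
    show ?thesis
    proof (cases "u = 0")
      case True
      then show ?thesis using 1 partner_p[of 1] p_1 q_1 M_ge
        by (auto simp: neighbours_def pred_def)
    next
      case False
      then show ?thesis using 1 assms by (auto simp: neighbours_def pred_def succ_def)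
    qed
  next
    case 2
    show ?thesis
    proof (cases "u = 2 * M - 1")
      case True
      then show ?thesis using 2 partner_q[of "Suc M"] p_M1 q_M1 M_ge
        by (auto simp: neighbours_def succ_def)
    next
      case False
      then show ?thesis using 2 by (auto simp: neighbours_def pred_def succ_def)
    qed
  next
    case 3
    then show ?thesis using mem_neighbours_partner assms by simp
  qed
qed

definition spiral_graph :: "nat pair_pre_digraph" where
  "spiral_graph = \<lparr>pverts = {..<2 * M}, parcs = Sigma {..<2 * M} neighbours\<rparr>"

text \<open>The third edge leaves the path toward the inner turn at values of \<open>p\<close> and
  toward the outer turn at values of \<open>q\<close>, hence two opposite cyclic orders.\<close>

definition turn :: "nat \<Rightarrow> nat \<Rightarrow> nat" where
  "turn u v =
    (if u \<in> p ` {1..M}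
     then if v = pred u then partner u else if v = partner u then succ u else pred u
     else if v = pred u then succ u else if v = succ u then partner u else pred u)"

definition rotation :: "nat \<times> nat \<Rightarrow> nat \<times> nat" where
  "rotation a = (if a \<in> parcs spiral_graph then (fst a, turn (fst a) (snd a)) else a)"

lemma spiral_graph_simps [simp]:
  "pverts spiral_graph = {..<2 * M}" "parcs spiral_graph = Sigma {..<2 * M} neighbours"
  by (simp_all add: spiral_graph_def)

lemma turn_in: "turn u v \<in> neighbours u"
  by (auto simp: turn_def neighbours_def)

lemma pair_graph_spiral_graph: "pair_graph spiral_graph"
proof
  show "symmetric spiral_graph"
    using neighbours_sym neighbours_lt
    by (fastforce simp: symmetric_def sym_def neighbours_def)
  show "finite (parcs spiral_graph)" using finite_neighbours by simp
  fix e assume "e \<in> parcs spiral_graph"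
  then show "fst e \<in> pverts spiral_graph" "snd e \<in> pverts spiral_graph" "fst e \<noteq> snd e"
    using neighbours_lt neighbours_distinct(4-6)[of "fst e"] by (auto simp: neighbours_def)
qed simp

lemma connected_spiral_graph: "connected spiral_graph"
proof -
  interpret pair_graph spiral_graph by (rule pair_graph_spiral_graph)
  let ?R = "\<lambda>u v. u \<rightarrow>\<^sup>*\<^bsub>with_proj spiral_graph\<^esub> v"
  have up: "?R 0 u \<and> ?R u 0" if "u < 2 * M" for u
    using that
  proof (induction u)
    case 0
    then show ?case by (simp add: reachable_refl)
  next
    case (Suc u)
    have "Suc u \<in> neighbours u" "u \<in> neighbours (Suc u)"
      using Suc.prems by (auto simp: neighbours_def succ_def pred_def)
    then have "?R u (Suc u)" "?R (Suc u) u" using Suc.prems by (auto intro!: reachable_adjI)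
    then show ?case using Suc by (meson Suc_lessD reachable_trans)
  qed
  show ?thesis
  proof (rule connectedI)
    show "pverts spiral_graph \<noteq> {}" using M_ge by (simp add: lessThan_empty_iff)
    fix u v assume "u \<in> pverts spiral_graph" "v \<in> pverts spiral_graph"
    then have "u \<rightarrow>\<^sup>*\<^bsub>with_proj spiral_graph\<^esub> v" using up[of u] up[of v] reachable_trans[of u 0 v]
      by simp
    then show "u \<rightarrow>\<^sup>*\<^bsub>with_proj (mk_symmetric (with_proj spiral_graph))\<^esub> v"
      by (rule reachable_mk_symmetricI)
  qed
qed

lemma out_arcs_spiral_graph:
  "u < 2 * M \<Longrightarrow> out_arcs spiral_graph u = {(u, pred u), (u, succ u), (u, partner u)}"
  by (auto simp: out_arcs_def neighbours_def)

lemma turn_inj: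
  assumes "u < 2 * M"
  shows "inj_on (turn u) (neighbours u)"
proof -
  have 3: "inj_on (\<lambda>v. if v = x then y else if v = y then z else x) {x, y, z}"
    if "x \<noteq> y" "x \<noteq> z" "y \<noteq> z" for x y z :: nat
    using that by (auto simp: inj_on_def)
  note d = neighbours_distinct[OF assms]
  show ?thesis
  proof (cases "u \<in> p ` {1..M}")
    case True
    show ?thesis
      using 3[of "pred u" "partner u" "succ u"] d True
      by (simp add: turn_def[abs_def] neighbours_def insert_commute)
  next
    case False
    show ?thesis
      using 3[of "pred u" "succ u" "partner u"] d False
      by (simp add: turn_def[abs_def] neighbours_def)
  qed
qed

lemma rotation_system_spiral_graph: "rotation_system spiral_graph rotation"
  unfolding rotation_system_def
proof (intro conjI ballI impI)
  have "inj_on rotation (parcs spiral_graph)"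
    using turn_inj by (auto intro!: inj_onI simp: rotation_def) (meson inj_onD)
  moreover have "rotation ` parcs spiral_graph \<subseteq> parcs spiral_graph"
    using turn_in by (auto simp: rotation_def)
  moreover have "finite (parcs spiral_graph)" using finite_neighbours by simp
  ultimately have "bij_betw rotation (parcs spiral_graph) (parcs spiral_graph)"
    by (metis bij_betw_def endo_inj_surj)
  then show "rotation permutes parcs spiral_graph"
    by (rule bij_imp_permutes) (simp add: rotation_def)
next
  fix u assume "u \<in> pverts spiral_graph"
  then have u: "u < 2 * M" by simp
  note d = neighbours_distinct[OF u]
  show "cyclic_on rotation (out_arcs spiral_graph u)"
  proof (cases "u \<in> p ` {1..M}")
    case True
    have "cyclic_on rotation {(u, pred u), (u, partner u), (u, succ u)}"
      by (rule cyclic_on_3I) (use u d True in \<open>auto simp: rotation_def turn_def neighbours_def\<close>)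
    then show ?thesis using out_arcs_spiral_graph[OF u] by (simp add: insert_commute)
  next
    case False
    have "cyclic_on rotation {(u, pred u), (u, succ u), (u, partner u)}"
      by (rule cyclic_on_3I) (use u d False in \<open>auto simp: rotation_def turn_def neighbours_def\<close>)
    then show ?thesis using out_arcs_spiral_graph[OF u] by simp
  qed
qed

lemma out_degree_spiral_graph: "u < 2 * M \<Longrightarrow> out_degree spiral_graph u = 3"
  using neighbours_distinct by (simp add: out_degree_def out_arcs_spiral_graph)

subsection \<open>Faces\<close>

lemma face_step_rotation:
  "v < 2 * M \<Longrightarrow> u \<in> neighbours v \<Longrightarrow> face_step rotation (u, v) = (v, turn v u)"
  by (simp add: face_step_def rotation_def)

text \<open>A forward walk along the path turns off at values of \<open>p\<close> and runs straight
  through values of \<open>q\<close>; a backward walk does the reverse. So a face has one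
  \<open>p\<close>-segment and one \<open>q\<close>-segment.\<close>

lemma face_step_at_p:
  assumes "1 \<le> n" "n \<le> M"
  shows "face_step rotation (pred (p n), p n) = (p n, q n)"
    and "face_step rotation (q n, p n) = (p n, succ (p n))"
    and "face_step rotation (succ (p n), p n) = (p n, pred (p n))"
  using assms neighbours_distinct(1-3)[of "p n"] p_lt[of n] partner_p[of n]
  by (auto simp: face_step_rotation turn_def neighbours_def)

lemma face_step_at_q:
  assumes "2 \<le> n" "n \<le> M + 1"
  shows "face_step rotation (pred (q n), q n) = (q n, succ (q n))"
    and "face_step rotation (succ (q n), q n) = (q n, p n)"
    and "face_step rotation (p n, q n) = (q n, pred (q n))"
proof -
  have "q n < 2 * M" using q_le[of n] assms M_ge by simp
  then show "face_step rotation (pred (q n), q n) = (q n, succ (q n))"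
    and "face_step rotation (succ (q n), q n) = (q n, p n)"
    and "face_step rotation (p n, q n) = (q n, pred (q n))"
    using assms neighbours_distinct(1-3)[of "q n"] partner_q[of n] q_not_p[of n]
    by (auto simp: face_step_rotation turn_def neighbours_def)
qed

text \<open>Strictly between \<open>p n\<close> and \<open>p (Suc n)\<close> there are, by
  \<open>partition\<close>, only values of \<open>q\<close>, and the walk runs straight through
  them.\<close>

lemma face_step_forward:
  assumes "n \<le> M" "p n \<le> t" "t < p (Suc n)"
  shows "face_step rotation (t, Suc t) =
    (if Suc t < p (Suc n) then (Suc t, Suc (Suc t)) else (p (Suc n), q (Suc n)))"
proof -
  have n: "n < M" using assms p_M p_M1 by (cases "n = M") auto
  have lt: "p (Suc n) < 2 * M" using p_lt[of "Suc n"] n by simp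
  show ?thesis
  proof (cases "Suc t < p (Suc n)")
    case True
    have no: "Suc t \<noteq> p i" if "1 \<le> i" "i \<le> M" for i
      using p_mono[of i n] p_mono[of "Suc n" i] that True assms n by (cases "i \<le> n") auto
    from True lt have "Suc t < 2 * M" by simp
    then obtain i where "2 \<le> i" "i \<le> M + 1" "Suc t = q i"
      using no by (cases rule: vertex_cases) blast+
    moreover have "pred (Suc t) = t" "succ (Suc t) = Suc (Suc t)"
      using True lt by (auto simp: pred_def succ_def)
    ultimately show ?thesis using face_step_at_q(1)[of i] True by metis
  next
    case False
    then have "Suc t = p (Suc n)" using assms by simp
    moreover have "pred (Suc t) = t" by (simp add: pred_def)
    ultimately show ?thesis using face_step_at_p(1)[of "Suc n"] n False by simp
  qed
qed

lemma face_step_backward: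
  assumes "1 \<le> n" "n \<le> M + 1" "q n \<le> t" "t < q (Suc n)"
  shows "face_step rotation (Suc t, t) = (if q n < t then (t, t - 1) else (q n, p n))"
proof -
  have n: "2 \<le> n" using assms q_1 q_2 by (cases "n = 1") (auto simp: numeral_2_eq_2)
  have lt: "q (Suc n) \<le> 2 * M - 1" using q_mono[of "Suc n" "M + 2"] assms q_M2 by simp
  have s: "succ t = Suc t" using lt assms by (auto simp: succ_def)
  show ?thesis
  proof (cases "q n < t")
    case True
    have no: "t \<noteq> q i" if "2 \<le> i" "i \<le> M + 1" for i
      using q_mono[of i n] q_mono[of "Suc n" i] that True assms by (cases "i \<le> n") auto
    have "t < 2 * M" using lt assms by simp
    then obtain i where "1 \<le> i" "i \<le> M" "t = p i"
      using no by (cases rule: vertex_cases) blast+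
    moreover have "pred t = t - 1" using True by (simp add: pred_def)
    ultimately show ?thesis using face_step_at_p(3)[of i] s True by metis
  next
    case False
    then have "t = q n" using assms by simp
    then show ?thesis using face_step_at_q(2)[of n] n assms s by simp
  qed
qed

text \<open>Removing \<open>Id\<close> drops the pairs \<open>(q 0, p 0)\<close> and \<open>(p (M + 2), q (M + 2))\<close>,
  which are not arcs.\<close>

definition face :: "nat \<Rightarrow> (nat \<times> nat) set" where
  "face n = {(t, Suc t) |t. p n \<le> t \<and> t < p (Suc n)} \<union> {(Suc t, t) |t. q n \<le> t \<and> t < q (Suc n)}
    \<union> ({(p (Suc n), q (Suc n)), (q n, p n)} - Id)"

lemma face_middle:
  assumes "1 \<le> n" "n \<le> M"
  shows "face n = {(t, Suc t) |t. p n \<le> t \<and> t < p (Suc n)} \<union> {(Suc t, t) |t. q n \<le> t \<and> t < q (Suc n)}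
    \<union> {(p (Suc n), q (Suc n)), (q n, p n)}"
  using assms q_less_p[of n] q_less_p[of "Suc n"] by (auto simp: face_def)

lemma face_0: "face 0 = {(0, 1), (1, 2), (2, 3), (3, 4), (4, 0)}"
  using p_0 p_1 q_0 q_1
  by (auto simp: face_def eval_nat_numeral less_Suc_eq)

lemma face_last:
  assumes "2 * M = k + 5"
  shows "face (M + 1) = {(k + 4, k + 3), (k + 3, k + 2), (k + 2, k + 1), (k + 1, k), (k, k + 4)}"
proof -
  have pq: "p (Suc M) = k + 4" "p (Suc (Suc M)) = k + 4" "q (Suc M) = k" "q (Suc (Suc M)) = k + 4"
    using assms p_M1 p_M2 q_M1 q_M2 by auto
  have "{(Suc t, t) |t. k \<le> t \<and> t < k + 4} = (\<lambda>t. (Suc t, t)) ` {k..<k + 4}" by auto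
  also have "{k..<k + 4} = {k + 3, k + 2, k + 1, k}" by auto
  finally have B: "{(Suc t, t) |t. k \<le> t \<and> t < k + 4}
      = {(k + 4, k + 3), (k + 3, k + 2), (k + 2, k + 1), (k + 1, k)}"
    by (simp add: eval_nat_numeral)
  have "face (M + 1) = {(t, Suc t) |t. k + 4 \<le> t \<and> t < k + 4} \<union> {(Suc t, t) |t. k \<le> t \<and> t < k + 4}
      \<union> ({(k + 4, k + 4), (k, k + 4)} - Id)"
    by (simp add: face_def pq)
  also have "\<dots> = {(k + 4, k + 3), (k + 3, k + 2), (k + 2, k + 1), (k + 1, k), (k, k + 4)}"
    unfolding B by auto
  finally show ?thesis .
qed

lemma cyclic_face:
  assumes "n \<le> M + 1"
  shows "cyclic_on (face_step rotation) (face n)"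
proof -
  consider "n = 0" | "1 \<le> n" "n \<le> M" | "n = M + 1" using assms by linarith
  then show ?thesis
  proof cases
    case 1
    have "face_step rotation (t, Suc t) = (Suc t, Suc (Suc t))" if "t < 3" for t
      using face_step_forward[of 0 t] that p_0 p_1 by simp
    from this[of 0] this[of 1] this[of 2]
    have "face_step rotation (0, 1) = (1, 2)" "face_step rotation (1, 2) = (2, 3)"
      "face_step rotation (2, 3) = (3, 4)"
      by (simp_all add: eval_nat_numeral)
    moreover have "face_step rotation (3, 4) = (4, 0)"
      using face_step_forward[of 0 3] p_0 p_1 q_1 by simp
    moreover have "face_step rotation (4, 0) = (0, 1)"
      using face_step_at_q(1)[of 2] q_2 M_ge by (simp add: pred_def succ_def)
    ultimately show ?thesis unfolding 1 face_0 by (rule cyclic_on_5I)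
  next
    case 2
    show ?thesis unfolding face_middle[OF 2]
    proof (rule face_walk_cyclic)
      show "p n \<le> p (Suc n)" "q n \<le> q (Suc n)" using 2 p_mono_Suc q_mono_Suc by auto
      \<comment> \<open>Degenerate segments: for \<open>n = 1\<close> the \<open>q\<close>-segment
        is vertex 0, where \<open>pred\<close> leads to \<open>p 1\<close>; for
        \<open>n = M\<close>, below, the \<open>p\<close>-segment is vertex
        \<open>2 * M - 1\<close>, where \<open>succ\<close> leads to
        \<open>q (Suc M)\<close>.\<close>
      have "q n < q (Suc n) \<longleftrightarrow> n \<noteq> 1" "q (Suc n) \<noteq> 0 \<longleftrightarrow> n \<noteq> 1"
        using q_less_Suc[of n] 2 q_1 q_2 by (cases "n = 1"; simp add: numeral_2_eq_2)+
      then show "face_step rotation (p (Suc n), q (Suc n)) =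
          (if q n < q (Suc n) then (q (Suc n), q (Suc n) - 1) else (q n, p n))"
        using face_step_at_q(3)[of "Suc n"] 2 q_1 p_1 by (auto simp: pred_def)
      show "face_step rotation (q n, p n) =
          (if p n < p (Suc n) then (p n, Suc (p n)) else (p (Suc n), q (Suc n)))"
      proof (cases "n = M")
        case True
        then show ?thesis using face_step_at_p(2)[of n] 2 p_M p_M1 q_M1 by (simp add: succ_def)
      next
        case False
        then have "p n < p (Suc n)" "p n < p M" using p_less_Suc[of n] p_less[of n M] 2 by auto
        then show ?thesis using face_step_at_p(2)[of n] 2 p_M by (simp add: succ_def)
      qed
    qed (use face_step_forward face_step_backward 2 in auto)
  next
    case 3
    define k where "k = 2 * M - 5"
    have k: "2 * M = k + 5" using M_ge by (simp add: k_def)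
    have pq: "p (Suc M) = k + 4" "q (Suc M) = k" "q (Suc (Suc M)) = k + 4" "p M = k + 4"
      using k p_M1 q_M1 q_M2 p_M by auto
    have "face_step rotation (Suc t, t) = (t, t - 1)" if "k < t" "t < k + 4" for t
      using face_step_backward[of "M + 1" t] that pq by simp
    from this[of "k + 3"] this[of "k + 2"] this[of "k + 1"]
    have "face_step rotation (k + 4, k + 3) = (k + 3, k + 2)"
      "face_step rotation (k + 3, k + 2) = (k + 2, k + 1)"
      "face_step rotation (k + 2, k + 1) = (k + 1, k)"
      by (simp_all add: eval_nat_numeral)
    moreover have "face_step rotation (k + 1, k) = (k, k + 4)"
      using face_step_backward[of "M + 1" k] pq by simp
    moreover have "face_step rotation (k, k + 4) = (k + 4, k + 3)"
      using face_step_at_p(3)[of M] pq k M_ge by (simp add: pred_def succ_def)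
    ultimately show ?thesis unfolding 3 face_last[OF k] by (rule cyclic_on_5I)
  qed
qed

lemma face_subset: "n \<le> M + 1 \<Longrightarrow> face n \<subseteq> parcs spiral_graph"
proof
  fix a assume n: "n \<le> M + 1" and a: "a \<in> face n"
  have p: "p (Suc n) \<le> 2 * M - 1" using p_mono[of "Suc n" "M + 2"] n p_M2 by simp
  have q: "q (Suc n) \<le> 2 * M - 1" using q_mono[of "Suc n" "M + 2"] n q_M2 by simp
  from a consider t where "a = (t, Suc t)" "t < p (Suc n)" | t where "a = (Suc t, t)" "t < q (Suc n)"
    | "a = (p (Suc n), q (Suc n))" "p (Suc n) \<noteq> q (Suc n)" | "a = (q n, p n)" "q n \<noteq> p n"
    by (auto simp: face_def)
  then show "a \<in> parcs spiral_graph"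
  proof cases
    case (1 t)
    then show ?thesis using p by (auto simp: neighbours_def succ_def)
  next
    case (2 t)
    then show ?thesis using q by (auto simp: neighbours_def pred_def)
  next
    case 3
    then have "n \<noteq> M + 1" using p_M2 q_M2 by auto
    then consider "Suc n \<le> M" | "n = M" using n by linarith
    then have "q (Suc n) \<in> neighbours (p (Suc n))"
      using partner_p[of "Suc n"] p_M1 q_M1 by cases (auto simp: neighbours_def succ_def)
    then show ?thesis using 3 p M_ge by simp
  next
    case 4
    then have "n \<noteq> 0" using p_0 q_0 by (metis)
    then consider "n = 1" | "2 \<le> n" by linarith
    then have "p n \<in> neighbours (q n)"
      using partner_q[of n] n p_1 q_1 by cases (auto simp: neighbours_def pred_def)
    then show ?thesis using 4 q_le[of n] n M_ge by simp
  qed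
qed

text \<open>A discrete intermediate value argument; it finds the segment containing a given path
  edge.\<close>

lemma interval_index:
  fixes g :: "nat \<Rightarrow> nat"
  assumes "g 0 \<le> t" "t < g m"
  shows "\<exists>n<m. g n \<le> t \<and> t < g (Suc n)"
  using assms
proof (induction m)
  case (Suc m)
  then show ?case by (cases "t < g m") (auto intro: less_SucI)
qed simp

text \<open>Completeness of the list: with \<open>cyclic_face\<close>, there are no faces besides
  the \<open>face n\<close>.\<close>

lemma arcs_eq: "parcs spiral_graph = (\<Union>n\<le>M + 1. face n)"
proof
  show "(\<Union>n\<le>M + 1. face n) \<subseteq> parcs spiral_graph" using face_subset by blast
  show "parcs spiral_graph \<subseteq> (\<Union>n\<le>M + 1. face n)"
  proof
    fix a assume "a \<in> parcs spiral_graph"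
    then obtain u v where a: "a = (u, v)" and u: "u < 2 * M" and v: "v \<in> neighbours u" by auto
    have f: "\<exists>n\<le>M + 1. (t, Suc t) \<in> face n" if "t < 2 * M - 1" for t
      using interval_index[of p t "M + 2"] that p_0 p_M2 by (auto simp: face_def less_Suc_eq_le)
    have b: "\<exists>n\<le>M + 1. (Suc t, t) \<in> face n" if "t < 2 * M - 1" for t
      using interval_index[of q t "M + 2"] that q_0 q_M2 by (auto simp: face_def less_Suc_eq_le)
    from v consider "v = pred u" | "v = succ u" | "v = partner u" by (auto simp: neighbours_def)
    then have "\<exists>n\<le>M + 1. (u, v) \<in> face n"
    proof cases
      case 1
      show ?thesis
      proof (cases "u = 0")
        case True
        then have "(u, v) \<in> face 1" using 1 p_1 q_1 by (simp add: face_def pred_def)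
        then show ?thesis by auto
      next
        case False
        then show ?thesis using b[of "u - 1"] 1 u by (simp add: pred_def)
      qed
    next
      case 2
      show ?thesis
      proof (cases "u = 2 * M - 1")
        case True
        then have "(u, v) \<in> face M" using 2 p_M1 q_M1 M_ge by (simp add: face_def succ_def)
        then show ?thesis by (intro exI[of _ M]) simp
      next
        case False
        then show ?thesis using f[of u] 2 u by (simp add: succ_def)
      qed
    next
      case 3
      from u show ?thesis
      proof (cases rule: vertex_cases)
        case (1 n)
        then have "(u, v) \<in> face (n - 1)"
          using 3 partner_p[of n] q_less_p[of n] by (auto simp: face_def)
        then show ?thesis using 1 by (intro exI[of _ "n - 1"]) auto
      next
        case (2 n)
        then have "(u, v) \<in> face n"
          using 3 partner_q[of n] q_less_p[of n] by (auto simp: face_def)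
        then show ?thesis using 2 by auto
      qed
    qed
    then show "a \<in> (\<Union>n\<le>M + 1. face n)" using a by auto
  qed
qed

lemma faces_eq: "faces spiral_graph rotation = face ` {..M + 1}"
proof -
  have "orbit (face_step rotation) ` face n = {face n}" if "n \<le> M + 1" for n
    using cyclic_face[OF that] orbit_cyclic_eq3[OF cyclic_face[OF that]]
    by (auto simp: cyclic_on_def image_iff)
  then show ?thesis by (auto simp: faces_def arcs_eq image_UN simp del: spiral_graph_simps)
qed

text \<open>This arc is a fingerprint of face \<open>m\<close>: it separates the faces and
  identifies the neighbour across a spiral edge.\<close>

lemma outer_arc_iff:
  assumes "1 \<le> m" "m \<le> M + 1" "n \<le> M + 1"
  shows "(q m, p m) \<in> face n \<longleftrightarrow> n = m"
proof
  assume "n = m"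
  then show "(q m, p m) \<in> face n" using q_less_p[of m] assms by (auto simp: face_def)
next
  note m = q_less_p[OF assms(1,2)]
  have no: "(q m, p m) \<noteq> (p (Suc n), q (Suc n))" if "p (Suc n) \<noteq> q (Suc n)"
    using m q_less_p[of "Suc n"] assms that p_M2 q_M2 by (cases "n = Suc M") auto
  assume "(q m, p m) \<in> face n"
  then have eq: "q m = q n" "p m = p n" "q n \<noteq> p n" using m no by (auto simp: face_def)
  then have n: "1 \<le> n" using p_0 q_0 by (cases n) auto
  show "n = m"
  proof (rule ccontr)
    assume "n \<noteq> m"
    then have "n < m \<or> m < n" by auto
    moreover have "p i = p j \<Longrightarrow> q i = q j \<Longrightarrow> \<not> i < j" if "1 \<le> i" "j \<le> M + 1" for i j
    proof
      assume e: "p i = p j" "q i = q j" and "i < j"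
      \<comment> \<open>In this range \<open>q\<close> repeats a value only at 1 and 2, and
        \<open>p\<close> does not.\<close>
      then have "i = 1" using q_less[of i j] that by force
      then show False using p_less[of 1 2] p_mono[of 2 j] e \<open>i < j\<close> that M_ge by simp
    qed
    ultimately show False using eq n assms by metis
  qed
qed

lemma face_inj: "inj_on face {..M + 1}"
proof (rule inj_onI)
  fix m n assume mn: "m \<in> {..M + 1}" "n \<in> {..M + 1}" "face m = face n"
  show "m = n"
  proof (cases "m = 0")
    case True
    show ?thesis
    proof (rule ccontr)
      assume "m \<noteq> n"
      then have "(q n, p n) \<in> face m" using outer_arc_iff[of n n] mn True by simp
      then show False using outer_arc_iff[of n m] mn True \<open>m \<noteq> n\<close> by simp
    qed
  next
    case False
    then have "(q m, p m) \<in> face n" using outer_arc_iff[of m m] mn by simp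
    then show ?thesis using outer_arc_iff[of m n] mn False by simp
  qed
qed

section \<open>Face lengths and numbers of faces\<close>

lemma card_face:
  assumes "1 \<le> n" "n \<le> M"
  shows "card (face n) + p n + q n = p (Suc n) + q (Suc n) + 2"
proof -
  let ?A = "(\<lambda>t. (t, Suc t)) ` {p n..<p (Suc n)}"
  let ?B = "(\<lambda>t. (Suc t, t)) ` {q n..<q (Suc n)}"
  let ?C = "{(p (Suc n), q (Suc n)), (q n, p n)}"
  have le: "q n + 3 \<le> p n" "q (Suc n) + 3 \<le> p (Suc n)" using q_less_p assms by auto
  have "card (face n) = card ((?A \<union> ?B) \<union> ?C)"
    unfolding face_middle[OF assms] by (rule arg_cong[of _ _ card]) auto
  also have "\<dots> = card (?A \<union> ?B) + card ?C"
    by (rule card_Un_disjoint) (use le in auto)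
  also have "card (?A \<union> ?B) = card ?A + card ?B" by (rule card_Un_disjoint) auto
  also have "card ?C = 2" using le by auto
  finally have "card (face n) = card ?A + card ?B + 2" .
  moreover have "card ?A = p (Suc n) - p n" "card ?B = q (Suc n) - q n"
    by (auto simp: card_image inj_on_def)
  ultimately have "card (face n) = (p (Suc n) - p n) + (q (Suc n) - q n) + 2"
    by simp
  then show ?thesis using p_mono_Suc[of n] q_mono_Suc[of n] assms by simp
qed

lemma card_face_0: "card (face 0) = 5"
  by (simp add: face_0)

lemma card_face_last: "card (face (M + 1)) = 5"
proof -
  define k where "k = 2 * M - 5"
  have "2 * M = k + 5" using M_ge by (simp add: k_def)
  then show ?thesis using face_last[of k] by simp
qed

text \<open>A middle face has two spiral edges besides its path edges, so increments 3 and 4 give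
  lengths 5 and 6. The end faces have increment 4 but a single spiral edge.\<close>

definition pentagonal :: "nat \<Rightarrow> bool" where
  "pentagonal n \<longleftrightarrow> n = 0 \<or> n = M + 1 \<or> p (Suc n) + q (Suc n) = p n + q n + 3"

lemma card_face_eq:
  assumes "n \<le> M + 1"
  shows "card (face n) = (if pentagonal n then 5 else 6)"
proof -
  consider "n = 0" | "n = M + 1" | "1 \<le> n" "n \<le> M" using assms by linarith
  then show ?thesis
  proof cases
    case 3
    then show ?thesis using card_face[OF 3] gap_3_or_4[of n] by (auto simp: pentagonal_def)
  qed (simp_all add: card_face_0 card_face_last[simplified] pentagonal_def)
qed

text \<open>Telescoping: \<open>p + q\<close> rises from 0 to \<open>4 * M - 2\<close> in
  \<open>M + 2\<close> steps, which is 10 short of steps of 4 throughout; each step of 3 accounts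
  for 1, and the two ends are added.\<close>

lemma card_pentagonal: "card {n. n \<le> M + 1 \<and> pentagonal n} = 12"
proof -
  let ?g = "\<lambda>n. p (Suc n) + q (Suc n) = p n + q n + 3"
  have "p m + q m + card {n. n < m \<and> ?g n} = 4 * m" if "m \<le> M + 2" for m
    using that
  proof (induction m)
    case 0
    then show ?case by (simp add: p_0 q_0)
  next
    case (Suc m)
    have "{n. n < Suc m \<and> ?g n} = (if ?g m then insert m {n. n < m \<and> ?g n} else {n. n < m \<and> ?g n})"
      by (auto simp: less_Suc_eq)
    then have "card {n. n < Suc m \<and> ?g n} = card {n. n < m \<and> ?g n} + (if ?g m then 1 else 0)"
      by simp
    then show ?case using Suc gap_3_or_4[of m] by auto
  qed
  from this[of "M + 2"] have 10: "card {n. n < M + 2 \<and> ?g n} = 10"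
    using p_M2 q_M2 M_ge by simp
  have "\<not> ?g 0" "\<not> ?g (M + 1)" using p_0 p_1 q_0 q_1 p_M1 p_M2 q_M1 q_M2 M_ge by auto
  then have "{n. n \<le> M + 1 \<and> pentagonal n} = insert 0 (insert (M + 1) {n. n < M + 2 \<and> ?g n})"
    by (auto simp: pentagonal_def)
  then show ?thesis using 10 \<open>\<not> ?g 0\<close> \<open>\<not> ?g (M + 1)\<close> by simp
qed

lemma pentagons_eq: "pentagons spiral_graph rotation = face ` {n. n \<le> M + 1 \<and> pentagonal n}"
  by (auto simp: pentagons_def faces_eq card_face_eq split: if_splits)

lemma hexagons_eq: "hexagons spiral_graph rotation = face ` {n. n \<le> M + 1 \<and> \<not> pentagonal n}"
  by (auto simp: hexagons_def faces_eq card_face_eq split: if_splits)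

lemma card_hexagons: "card (hexagons spiral_graph rotation) = M - 10"
proof -
  have "card (hexagons spiral_graph rotation) = card {n. n \<le> M + 1 \<and> \<not> pentagonal n}"
    unfolding hexagons_eq by (rule card_image) (rule inj_on_subset[OF face_inj], auto)
  also have "{n. n \<le> M + 1 \<and> \<not> pentagonal n} = {..M + 1} - {n. n \<le> M + 1 \<and> pentagonal n}"
    by auto
  also have "card \<dots> = card {..M + 1} - 12"
    using card_pentagonal by (subst card_Diff_subset) auto
  finally show ?thesis by simp
qed

lemma fullerene_spiral_graph: "fullerene spiral_graph rotation"
proof -
  have "card (faces spiral_graph rotation) = M + 2"
    unfolding faces_eq using card_image[OF face_inj] by simp
  moreover have "card (parcs spiral_graph) = 6 * M"
    using finite_neighbours card_neighbours by (simp add: card_SigmaI)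
  \<comment> \<open>\<open>2 * M\<close> vertices, \<open>3 * M\<close> edges and
    \<open>M + 2\<close> faces.\<close>
  ultimately have "euler_char spiral_graph rotation = 2"
    unfolding euler_char_def by (simp del: spiral_graph_simps(2))
  moreover have "\<forall>f\<in>faces spiral_graph rotation.
      f \<in> pentagons spiral_graph rotation \<or> f \<in> hexagons spiral_graph rotation"
    by (auto simp: faces_eq pentagons_eq hexagons_eq)
  ultimately show ?thesis
    using pair_graph_spiral_graph connected_spiral_graph rotation_system_spiral_graph out_degree_spiral_graph
    by (auto simp: fullerene_def connected_plane_graph_def)
qed

subsection \<open>Distances between faces\<close>

lemma q_ge: "n \<le> M + 2 \<Longrightarrow> n \<le> q n + 2"
proof (induction n)
  case (Suc n)
  then show ?case using q_less_Suc[of n] by (cases "n < 2") auto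
qed simp

lemma p_le:
  assumes "n \<le> M + 2"
  shows "p n + 1 \<le> M + n"
proof -
  have *: "p n + (M - n) \<le> p M" if "1 \<le> n" "n \<le> M" for n
    using that(2,1)
  proof (induction n rule: inc_induct)
    case (step n)
    then show ?case using p_less_Suc[of n] by simp
  qed simp
  consider "n = 0" | "1 \<le> n" "n \<le> M" | "M < n" by linarith
  then show ?thesis
    using *[of n] p_lt[OF assms] p_0 p_M M_ge by cases auto
qed

text \<open>A bounded ratio of indices counted from either end, since pentagons cluster at both. The
  shift by 3 makes the bound \<open>m \<le> 3 * n + 6\<close> a pure ratio.\<close>

definition near :: "nat \<Rightarrow> nat \<Rightarrow> bool" where
  "near n m \<longleftrightarrow> m + 3 \<le> 3 * (n + 3) \<and> n + 3 \<le> 3 * (m + 3) \<and>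
    (M + 1 - m) + 3 \<le> 3 * ((M + 1 - n) + 3) \<and> (M + 1 - n) + 3 \<le> 3 * ((M + 1 - m) + 3)"

lemma near_sym: "near n m \<longleftrightarrow> near m n"
  by (auto simp: near_def)

lemma near_Suc: "near n (Suc n)"
  by (auto simp: near_def)

text \<open>The faces on the two sides of a path edge. \<open>q\<close> grows with slope at least 1
  and \<open>p\<close> with slope at most 3, which bounds \<open>m\<close> by \<open>n\<close>;
  \<open>p_le\<close> and \<open>q_lower\<close> are the same bounds seen from the other
  end.\<close>

lemma near_strip:
  assumes "n \<le> M + 1" "m \<le> M + 1" "p n \<le> t" "t < p (Suc n)" "q m \<le> t" "t < q (Suc m)"
  shows "near n m"
proof -
  have "n \<le> m"
  proof (rule ccontr)
    assume "\<not> n \<le> m"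
    then have "q (Suc m) \<le> q n" "q n + 3 \<le> p n" using q_mono[of "Suc m" n] q_less_p[of n] assms by auto
    then show False using assms by linarith
  qed
  moreover have "m \<le> 3 * n + 6"
    using q_ge[of m] p_upper[of "Suc n"] assms by simp
  moreover have "3 * m \<le> 2 * M + n + 8"
    using q_lower[of m] p_le[of "Suc n"] assms by simp
  ultimately show ?thesis using assms by (auto simp: near_def)
qed

text \<open>A shared path edge is the case of \<open>near_strip\<close>; a shared spiral edge,
  recognised by its ends being at least 3 apart, joins consecutive faces by
  \<open>outer_arc_iff\<close>.\<close>

lemma adjacent_near:
  assumes nm: "n \<le> M + 1" "m \<le> M + 1" and a: "a \<in> face n" "prod.swap a \<in> face m"
  shows "near n m"
proof -
  have sep: "p k = q k \<or> q k + 3 \<le> p k" if k: "k \<le> M + 2" for k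
  proof -
    consider "k = 0" | "k = M + 2" | "1 \<le> k" "k \<le> M + 1"
      using k by linarith
    then show ?thesis using p_0 q_0 p_M2 q_M2 q_less_p[of k] by cases auto
  qed
  have cases: "(\<exists>t. x = (t, Suc t) \<and> p k \<le> t \<and> t < p (Suc k)) \<or>
      (\<exists>t. x = (Suc t, t) \<and> q k \<le> t \<and> t < q (Suc k)) \<or>
      (x = (p (Suc k), q (Suc k)) \<and> q (Suc k) + 3 \<le> p (Suc k) \<and> k \<le> M) \<or>
      (x = (q k, p k) \<and> q k + 3 \<le> p k \<and> 1 \<le> k)"
    if "x \<in> face k" "k \<le> M + 1" for x k
  proof -
    have "k = M + 1 \<Longrightarrow> p (Suc k) = q (Suc k)" "k = 0 \<Longrightarrow> p k = q k"
      using p_0 q_0 p_M2 q_M2 by auto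
    then show ?thesis using that sep[of k] sep[of "Suc k"] by (fastforce simp: face_def)
  qed
  obtain u v where uv: "a = (u, v)" by force
  have *: "near k l"
    if k: "k \<le> M + 1" and l: "l \<le> M + 1" and x: "(x, y) \<in> face k" "(y, x) \<in> face l" and "x < y"
    for k l x y
  proof (cases "y = Suc x")
    case True
    then have "p k \<le> x \<and> x < p (Suc k)" using cases[OF x(1) k] by auto
    moreover have "q l \<le> x \<and> x < q (Suc l)" using cases[OF x(2) l] True by auto
    ultimately show ?thesis using near_strip k l by blast
  next
    case False
    then have "x = q (Suc l)" "y = p (Suc l)" "l \<le> M" using cases[OF x(2) l] \<open>x < y\<close> by auto
    then have "k = Suc l" using outer_arc_iff[of "Suc l" k] x(1) k by simp
    then show ?thesis using near_Suc near_sym by simp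
  qed
  obtain u v where uv: "a = (u, v)" by force
  have "u \<noteq> v" using cases[OF a(1) nm(1)] uv by auto
  then consider "u < v" | "v < u" by linarith
  then show ?thesis
  proof cases
    case 1
    then show ?thesis using *[OF nm] a uv by simp
  next
    case 2
    then have "near m n" using *[OF nm(2,1)] a uv by simp
    then show ?thesis by (simp add: near_sym)
  qed
qed

definition index :: "(nat \<times> nat) set \<Rightarrow> nat" where
  "index = inv_into {..M + 1} face"

lemma index_face: "n \<le> M + 1 \<Longrightarrow> index (face n) = n"
  unfolding index_def by (rule inv_into_f_f[OF face_inj]) simp

lemma dual_arc_near:
  assumes "(f, g) \<in> parcs (dual_graph spiral_graph rotation)"
  shows "near (index f) (index g)"
proof -
  from assms obtain n m a where "n \<le> M + 1" "m \<le> M + 1" "f = face n" "g = face m"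
    "a \<in> f" "prod.swap a \<in> g"
    by (auto simp: dual_graph_def faces_eq)
  then show ?thesis using adjacent_near[of n m a] by (simp add: index_face)
qed

text \<open>The weight is the shifted index, counted from the start or from the end of the
  spiral.\<close>

lemma face_distance_face_ge:
  assumes "n \<le> M + 1" "m \<le> M + 1"
    and "3 ^ d * (n + 3) < m + 3 \<or> 3 ^ d * (M + 1 - m + 3) < M + 1 - n + 3"
  shows "face_distance spiral_graph rotation (face n) (face m) \<ge> ereal (real d)
    \<and> face_distance spiral_graph rotation (face m) (face n) \<ge> ereal (real d)"
proof -
  have low: "index g + 3 \<le> 3 * (index f + 3) \<and> index f + 3 \<le> 3 * (index g + 3)"
    and high: "M + 1 - index g + 3 \<le> 3 * (M + 1 - index f + 3)
      \<and> M + 1 - index f + 3 \<le> 3 * (M + 1 - index g + 3)"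
    if "(f, g) \<in> parcs (dual_graph spiral_graph rotation)" for f g
    using dual_arc_near[OF that] by (auto simp: near_def)
  note i = index_face[OF assms(1)] index_face[OF assms(2)]
  from assms(3) show ?thesis
  proof
    assume *: "3 ^ d * (n + 3) < m + 3"
    then have "3 ^ d * (index (face n) + 3) < index (face m) + 3" unfolding i .
    then show ?thesis
      by (intro conjI face_distance_ge[OF low]) auto
  next
    assume *: "3 ^ d * (M + 1 - m + 3) < M + 1 - n + 3"
    then have "3 ^ d * (M + 1 - index (face m) + 3) < M + 1 - index (face n) + 3" unfolding i .
    then show ?thesis
      by (intro conjI face_distance_ge[OF high]) auto
  qed
qed

lemma pentagon_separation_ge:
  assumes "\<And>n m. pentagonal n \<Longrightarrow> pentagonal m \<Longrightarrow> n < m \<Longrightarrow> m \<le> M + 1 \<Longrightarrow>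
    3 ^ d * (n + 3) < m + 3 \<or> 3 ^ d * (M + 1 - m + 3) < M + 1 - n + 3"
  shows "pentagon_separation spiral_graph rotation \<ge> ereal (real d)"
  unfolding pentagon_separation_def
proof (rule INF_greatest, clarify)
  fix f g
  assume "f \<in> pentagons spiral_graph rotation" "g \<in> pentagons spiral_graph rotation" "f \<noteq> g"
  then obtain n m where nm: "n \<le> M + 1" "m \<le> M + 1" "pentagonal n" "pentagonal m" "n \<noteq> m"
    "f = face n" "g = face m"
    by (auto simp: pentagons_eq)
  then consider "n < m" | "m < n" by linarith
  then show "ereal (real d) \<le> face_distance spiral_graph rotation f g"
    by cases (use face_distance_face_ge[of n m d] face_distance_face_ge[of m n d] assms[of n m]
      assms[of m n] nm in auto)
qed

end

section \<open>Closing the spiral\<close>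

text \<open>The first bound on \<open>M\<close> leaves room for both caps and a tube between them;
  the second separates the pentagons of different caps.\<close>

locale closed_spiral = spiral_cap +
  fixes L x M :: nat
  assumes L_ge: "2 \<le> L"
    and tube: "L \<le> n \<Longrightarrow> p n = 2 * n + x \<and> q n + x + 5 = 2 * n"
    and M_large: "10 * L + 20 \<le> M" "C * (L + 3) + L \<le> M"
begin

text \<open>The map \<open>t \<mapsto> 2 M - 1 - t\<close>, \<open>n \<mapsto> M + 2 - n\<close> exchanges \<open>P\<close> and \<open>Q\<close>: the half turn
  that exchanges the two ends. In the tube both branches of \<open>P\<close> agree.\<close>

definition P :: "nat \<Rightarrow> nat" where
  "P n = (if n + L \<le> M + 2 then p n else 2 * M - 1 - q (M + 2 - n))"

definition Q :: "nat \<Rightarrow> nat" where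
  "Q n = 2 * M - 1 - P (M + 2 - n)"

lemma q_upper: "q n \<le> 2 * n"
  using q_bounds[of n] q_0 q_1 by (cases "n < 2") (auto simp: less_2_cases_iff)

lemma P_low: "n + L \<le> M + 2 \<Longrightarrow> P n = p n"
  by (simp add: P_def)

text \<open>On the overlap \<open>(2 * n + x) + (2 * (M + 2 - n) - x - 5) + 1 = 2 * M\<close>,
  whatever \<open>M\<close> is; so the tube can be lengthened by single faces.\<close>

lemma P_high:
  assumes "L \<le> n" "n \<le> M + 2"
  shows "P n + q (M + 2 - n) + 1 = 2 * M"
proof (cases "n + L \<le> M + 2")
  case True
  have "L \<le> M + 2 - n" using True by simp
  then have "q (M + 2 - n) + x + 5 = 2 * (M + 2 - n)" using tube by blast
  then show ?thesis using tube[OF assms(1)] True assms M_large(1) by (simp add: P_def)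
next
  case False
  then show ?thesis using q_upper[of "M + 2 - n"] M_large(1) by (simp add: P_def)
qed

lemma Q_low:
  assumes "n + L \<le> M + 2"
  shows "Q n = q n"
proof -
  have "L \<le> M + 2 - n" "M + 2 - (M + 2 - n) = n" using assms by linarith+
  then have "P (M + 2 - n) + q n + 1 = 2 * M" using P_high[of "M + 2 - n"] by simp
  then show ?thesis by (simp add: Q_def)
qed

lemma Q_high:
  assumes "L \<le> n" "n \<le> M + 2"
  shows "Q n + p (M + 2 - n) + 1 = 2 * M"
proof -
  have "p (M + 2 - n) + 1 \<le> 2 * M"
  proof (cases "L \<le> M + 2 - n")
    case True
    then show ?thesis using tube[of "M + 2 - n"] tube[of L] assms by linarith
  next
    case False
    then show ?thesis using p_upper[of "M + 2 - n"] M_large(1) by simp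
  qed
  then show ?thesis using P_low[of "M + 2 - n"] assms by (simp add: Q_def)
qed

lemma p_less_Suc: "p n < p (Suc n)"
  using p_gap_ge[of n] p_0 p_1 by (cases "n = 0") auto

lemma P_upper: "n \<le> M + 2 \<Longrightarrow> P n \<le> 3 * n + 2"
  using p_upper[of n] M_large(1) unfolding P_def by (split if_split) linarith

text \<open>Low indices inherit each condition from the cap, high ones from its half turn, under
  which \<open>p\<close> and \<open>q\<close> change roles.\<close>

lemma closed: "spiral_map M P Q"
proof
  show "12 \<le> M" using M_large(1) by simp
  show "P 0 = 0" "P (Suc 0) = 4" "Q 0 = 0" "Q (Suc 0) = 0" "Q 2 = 0"
    using P_low[of 0] P_low[of "Suc 0"] Q_low[of 0] Q_low[of "Suc 0"] Q_low[of 2] M_large(1)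
      p_0 p_1 q_0 q_1 q_2 by simp_all
  show "P M = 2 * M - 1" "P (Suc M) = 2 * M - 1" "P (M + 2) = 2 * M - 1"
    using P_high[of M] P_high[of "Suc M"] P_high[of "M + 2"] M_large(1) q_0 q_1 q_2[unfolded numeral_2_eq_2]
    by (simp_all add: Suc_diff_le)
  show "Q (Suc M) = 2 * M - 5" "Q (M + 2) = 2 * M - 1"
    using Q_high[of "Suc M"] Q_high[of "M + 2"] M_large(1) p_0 p_1 by (simp_all add: Suc_diff_le)
next
  fix i assume i: "1 \<le> i" "i < M"
  show "P i < P (Suc i)"
  proof (cases "Suc i + L \<le> M + 2")
    case True
    then show ?thesis using p_less_Suc[of i] P_low[of i] P_low[of "Suc i"] by simp
  next
    case False
    have "Suc (M + 1 - i) = M + 2 - i" "M + 2 - Suc i = M + 1 - i" "2 \<le> M + 1 - i" using i by auto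
    then have "q (M + 2 - Suc i) < q (M + 2 - i)" using q_gap[of "M + 1 - i"] by auto
    then show ?thesis using P_high[of i] P_high[of "Suc i"] False i M_large(1) by simp
  qed
next
  fix i assume i: "2 \<le> i" "i \<le> M + 1"
  show "Q i < Q (Suc i)"
  proof (cases "Suc i + L \<le> M + 2")
    case True
    then show ?thesis using q_gap[of i] i Q_low[of i] Q_low[of "Suc i"] by auto
  next
    case False
    have "Suc (M + 1 - i) = M + 2 - i" "M + 2 - Suc i = M + 1 - i" using i by auto
    then have "p (M + 2 - Suc i) < p (M + 2 - i)" using p_less_Suc[of "M + 1 - i"] by auto
    then show ?thesis using Q_high[of i] Q_high[of "Suc i"] False i M_large(1) by simp
  qed
next
  fix n assume n: "1 \<le> n" "n \<le> M + 1"
  show "Q n + 3 \<le> P n"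
  proof (cases "n + L \<le> M + 2")
    case True
    then show ?thesis using q_less_p[of n] n P_low Q_low by simp
  next
    case False
    have "q (M + 2 - n) + 3 \<le> p (M + 2 - n)" using n by (intro q_less_p) linarith
    then show ?thesis using n P_high[of n] Q_high[of n] False M_large(1) by linarith
  qed
next
  fix i j assume ij: "1 \<le> i" "i \<le> M" "2 \<le> j" "j \<le> M + 1"
  \<comment> \<open>Either one copy of the cap covers both indices, or they lie at opposite ends and
    the values differ in size.\<close>
  consider "i + L \<le> M + 2" "j + L \<le> M + 2" | "L \<le> i" "L \<le> j"
    | "i < L" "M + 2 < j + L" | "M + 2 < i + L" "j < L" by linarith
  then show "P i \<noteq> Q j"
  proof cases
    case 1
    then show ?thesis using p_neq_q[of i j] P_low Q_low ij by simp
  next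
    case 2
    have "p (M + 2 - j) \<noteq> q (M + 2 - i)" using ij by (intro p_neq_q) linarith+
    then show ?thesis using 2 P_high[of i] Q_high[of j] ij by linarith
  next
    case 3
    then show ?thesis
      using P_low[of i] Q_high[of j] ij p_upper[of i] p_upper[of "M + 2 - j"] M_large(1) by simp
  next
    case 4
    then show ?thesis
      using P_high[of i] Q_low[of j] ij q_upper[of j] q_upper[of "M + 2 - i"] M_large(1) by simp
  qed
next
  fix n assume n: "n \<le> M + 1"
  show "P (Suc n) + Q (Suc n) = P n + Q n + 3 \<or> P (Suc n) + Q (Suc n) = P n + Q n + 4"
  proof (cases "Suc n + L \<le> M + 2")
    case True
    then show ?thesis using gap_3_or_4[of n] P_low Q_low by simp
  next
    case False
    have "Suc (M + 1 - n) = M + 2 - n" "M + 2 - Suc n = M + 1 - n" using n by auto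
    then show ?thesis
      using gap_3_or_4[of "M + 1 - n"] P_high[of n] Q_high[of n] P_high[of "Suc n"]
        Q_high[of "Suc n"] False n M_large(1) by auto
  qed
next
  fix n assume n: "n \<le> M + 2"
  show "P n \<le> 3 * n + 2" using P_upper[OF n] .
  show "3 * n \<le> Q n + M + 9" using P_upper[of "M + 2 - n"] n unfolding Q_def by linarith
qed

sublocale closed: spiral_map M P Q by (rule closed)

text \<open>In the tube \<open>p + q\<close> grows by exactly 4. The half turn sends edge
  \<open>n\<close> to \<open>M + 2 - n\<close>, hence the face between edges \<open>n\<close> and
  \<open>n + 1\<close> to \<open>M + 1 - n\<close>.\<close>

lemma pentagonal_cases:
  assumes "closed.pentagonal n" "n \<le> M + 1"
  shows "(n < L \<and> pentagon n) \<or> (M + 1 - n < L \<and> pentagon (M + 1 - n))"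
proof -
  have tube': "\<not> pentagon m" if "L \<le> m" for m
    using tube[of m] tube[of "Suc m"] that L_ge by (auto simp: pentagon_def)
  consider "n = 0" | "n = M + 1" | "P (Suc n) + Q (Suc n) = P n + Q n + 3"
    using assms by (auto simp: closed.pentagonal_def)
  then show ?thesis
  proof cases
    case 3
    show ?thesis
    proof (cases "Suc n + L \<le> M + 2")
      case True
      then have "pentagon n" using 3 P_low Q_low by (simp add: pentagon_def)
      then show ?thesis using tube' not_le by blast
    next
      case False
      have "Suc (M + 1 - n) = M + 2 - n" "M + 2 - Suc n = M + 1 - n" using assms by auto
      then have "pentagon (M + 1 - n)"
        using P_high[of n] Q_high[of n] P_high[of "Suc n"] Q_high[of "Suc n"] False assms 3
          M_large(1) by (simp add: pentagon_def)
      then show ?thesis using tube' not_le by blast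
    qed
  qed (use L_ge in \<open>auto simp: pentagon_def\<close>)
qed

text \<open>Within one cap the spacing of \<open>pentagons_apart\<close> applies, counted from that
  end; between the caps the length of the tube suffices.\<close>

lemma pentagonal_far:
  assumes "closed.pentagonal n" "closed.pentagonal m" "n < m" "m \<le> M + 1"
  shows "C * (n + 3) < m + 3 \<or> C * (M + 1 - m + 3) < M + 1 - n + 3"
proof -
  consider "n < L" "pentagon n" "m < L" "pentagon m"
    | "n < L" "M + 1 - m < L"
    | "M + 1 - n < L" "pentagon (M + 1 - n)" "M + 1 - m < L" "pentagon (M + 1 - m)"
    | "M + 1 - n < L" "m < L"
    using pentagonal_cases[of n] pentagonal_cases[of m] assms by auto
  then show ?thesis
  proof cases
    case 1
    then show ?thesis using pentagons_apart assms by blast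
  next
    case 2
    have "C * (n + 3) \<le> C * (L + 3)" using 2 by (intro mult_le_mono) auto
    then show ?thesis using 2 M_large(2) by linarith
  next
    case 3
    moreover have "M + 1 - m < M + 1 - n" using assms by simp
    ultimately show ?thesis using pentagons_apart by blast
  next
    case 4
    then show ?thesis using assms M_large(1) by linarith
  qed
qed

end

theorem theorem2:
  fixes d :: nat
  assumes "d > 0"
  shows "\<exists>h\<^sub>d::nat. \<forall>h\<ge>h\<^sub>d. \<exists>(G :: nat pair_pre_digraph) rot.
           fullerene G rot \<and>
           pentagon_separation G rot \<ge> ereal (real d) \<and>
           card (hexagons G rot) = h"
proof -
  \<comment> \<open>\<open>3 ^ d\<close> because one step in the dual changes the shifted index by a
    factor of at most 3.\<close>
  obtain p q k l where "spiral_cap (3 ^ d) p q k l" using spiral_cap_exists by blast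
  then interpret spiral_cap "3 ^ d" p q k l .
  obtain L x where L: "2 \<le> L" "\<And>n. L \<le> n \<Longrightarrow> p n = 2 * n + x \<and> q n + x + 5 = 2 * n"
    using eventually_tube by blast
  show ?thesis
  proof (intro exI allI impI)
    fix h assume h: "10 * L + 20 + (3 ^ d * (L + 3) + L) \<le> h"
    \<comment> \<open>\<open>M = h + 10\<close>, as there are \<open>M - 10\<close> hexagons; the
      threshold is the sum of the two bounds in \<open>M_large\<close>.\<close>
    interpret closed_spiral "3 ^ d" p q k l L x "h + 10"
      using L h by unfold_locales auto
    show "fullerene closed.spiral_graph closed.rotation \<and>
        pentagon_separation closed.spiral_graph closed.rotation \<ge> ereal (real d) \<and>
        card (hexagons closed.spiral_graph closed.rotation) = h"
      using closed.fullerene_spiral_graph closed.card_hexagons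
        closed.pentagon_separation_ge[OF pentagonal_far] by simp
  qed
qed

end
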